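(* Let $\mathbf{X},\mathbf{V}$ be tuples of finite types, $\prec$ a decidable binary relation on $\mathbf{X}$, $\phi(\mathbf{x})$ a quantifier-free formula, $P(\mathbf{x},\mathbf{y})$ a quantifier-free formula with $\mathbf{x}:\mathbf{X}$, $\mathbf{y}:\mathbf{V}$ (so that $\exists\mathbf{x}\,\forall\mathbf{y}\,P(\mathbf{x},\mathbf{y})$ is the Dialectica interpretation of $\exists\mathbf{x}\,P_\forall(\mathbf{x})$ for a formula $P_\forall(\mathbf{x})$ with purely universal Dialectica interpretation $\forall \mathbf{y}P(\mathbf{x},\mathbf{y})$), and let $\mathbf{a}:\mathbf{X}\to\mathbf{X}$ and $\boldsymbol{\alpha}:\mathbf{X}\to\mathbf{V}\to\mathbf{V}$ be terms. Let $T$ be the theory $\mathrm{WE}\text{-}\mathrm{HA}^\omega+\mathrm{IND}_\prec+(\mathrm{WR}_\prec)$. Suppose that $T$ proves \[\forall\mathbf{x},\mathbf{v}\left(P(\mathbf{x},\boldsymbol{\alpha}\mathbf{x}\mathbf{v})\wedge\phi(\mathbf{x})\to P(\mathbf{a}\mathbf{x},\mathbf{v})\right)\] (i.e. the Dialectica triple $\exists\mathbf{x}(P_\forall(\mathbf{x})\wedge\phi(\mathbf{x}))\,\langle\mathbf{a},\boldsymbol{\alpha}\rangle\,\exists\mathbf{x}\,P_\forall(\mathbf{x})$) and $T$ proves $\forall\mathbf{x}(\phi(\mathbf{x})\to\mathbf{a}\mathbf{x}\prec\mathbf{x})$. Then $T$ proves \[\forall\mathbf{x},\mathbf{v}\left(P(\mathbf{x},\mathbf{B}\mathbf{x}\mathbf{v})\to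 P(\mathbf{D}\mathbf{x},\mathbf{v})\wedge\neg\phi(\mathbf{D}\mathbf{x})\right),\] i.e. the Dialectica triple $\exists\mathbf{x}\,P_\forall(\mathbf{x})\,\langle\mathbf{D},\mathbf{B}\rangle\,\exists\mathbf{x}(P_\forall(\mathbf{x})\wedge\neg\phi(\mathbf{x}))$, where $\mathbf{D}:=\mathbf{W}^{\prec,\phi,\mathbf{a}}(\lambda\mathbf{x}.\mathbf{x})(\lambda\mathbf{x},\mathbf{y}.\mathbf{y})$ and $\mathbf{B}:=\mathbf{W}^{\prec,\phi,\mathbf{a}}(\lambda\mathbf{x},\mathbf{v}.\mathbf{v})(\lambda\mathbf{x},\mathbf{f},\mathbf{v}.\boldsymbol{\alpha}\mathbf{x}(\mathbf{f}\mathbf{v}))$. (That is, the while rule $(W_\prec)$ is admissible in $T$.)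
   Context: $\mathrm{WE}\text{-}\mathrm{HA}^\omega$ is weakly extensional intuitionistic arithmetic in all finite types with System T terms and a case constructor; for quantifier-free $\phi$, "if $\phi$ then $s$ else $t$" returns $s$ if $\phi$ holds and $t$ otherwise. Boldface letters denote tuples, with application and abstraction componentwise. A decidable relation $\prec$ on $\mathbf{X}$ is a term $\mathbf{X}\to\mathbf{X}\to\mathsf{nat}$. $\mathrm{IND}_\prec$ is the wellfounded induction rule: from $\forall\mathbf{x}(\forall\mathbf{y}\prec\mathbf{x}\,A(\mathbf{y})\to A(\mathbf{x}))$ infer $\forall\mathbf{x}\,A(\mathbf{x})$, for arbitrary formulas $A$. $(\mathrm{WR}_\prec)$: for each quantifier-free $\phi(\mathbf{x})$, term $\mathbf{a}:\mathbf{X}\to\mathbf{X}$ and tuple of types $\mathbf{U}$ there is a constant $\mathbf{W}^{\prec,\phi,\mathbf{a}}:(\mathbf{X}\to\mathbf{U})\to(\mathbf{X}\to\mathbf{U}\to\mathbf{U})\to\mathbf{X}\to\mathbf{U}$ with axiom $(\phi(\mathbf{x})\to\mathbf{a}\mathbf{x}\prec\mathbf{x})\to\mathbf{W}^{\prec,\phi,\mathbf{a}}\mathbf{u}\mathbf{F}\mathbf{x}=(\text{if }\phi(\mathbf{x})\text{ then }\mathbf{F}\mathbf{x}(\mathbf{W}^{\prec,\phi,\mathbf{a}}\mathbf{u}\mathbf{F}(\mathbf{a}\mathbf{x}))\text{ else }\mathbf{u}\mathbf{x})$. A Dialectica triple $A\,\langle\mathbf{a},\boldsymbol{\alpha}\rangle\,B$,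 for formulas $A,B$ with Dialectica interpretations $\exists\mathbf{x}\forall\mathbf{y}A_D(\mathbf{x},\mathbf{y})$ and $\exists\mathbf{u}\forall\mathbf{v}B_D(\mathbf{u},\mathbf{v})$, is the formula $\forall\mathbf{x},\mathbf{v}(A_D(\mathbf{x},\boldsymbol{\alpha}\mathbf{x}\mathbf{v})\to B_D(\mathbf{a}\mathbf{x},\mathbf{v}))$. *)

theory Defs
  imports Main
begin

text \<open>
  A deep embedding of WE-HA\<open>\<^sup>\<omega>\<close> + IND + (WR) for one fixed relation \<open>\<prec>\<close>.  Variables are de Bruijn
  indices.  A context lists the types of the free variables, index \<open>0\<close> first, so that binding a
  tuple of types \<open>X\<close> (from left to right) turns the context \<open>\<Gamma>\<close> into \<open>rev X @ \<Gamma>\<close>.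
  Tuples of types and of terms are lists.
\<close>

datatype ty = NatT | Arr ty ty

definition funs :: "ty list \<Rightarrow> ty \<Rightarrow> ty" where
  "funs X \<tau> = foldr Arr X \<tau>"

text \<open>
  \<open>Cond \<phi> s t\<close> is ``if \<open>\<phi>\<close> then \<open>s\<close> else \<open>t\<close>''.  \<open>WRec \<phi> a U i\<close> is the \<open>i\<close>-th component (counting from
  \<open>0\<close>) of the tuple of constants \<open>W\<close> with indices \<open>\<prec>\<close>, \<open>\<phi>\<close>, \<open>a\<close> at the tuple of result types \<open>U\<close>; the
  relation \<open>\<prec>\<close> and the tuple \<open>X\<close> it lives on are fixed parameters of the theory, hence not recorded.
  Being a constant, it is left alone by renaming and substitution; well-typedness demands that
  \<open>\<phi>\<close> has no variables other than \<open>x\<close> and that \<open>a\<close> is closed.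
\<close>

datatype tm =
    Var nat
  | App tm tm
  | Lam ty tm
  | Zero
  | Succ
  | Rec ty
  | Cond fm tm tm
  | WRec fm "tm list" "ty list" nat
and fm =
    Eq tm tm
  | Bot
  | And fm fm
  | Or fm fm
  | Imp fm fm
  | Forall ty fm
  | Exists ty fm

abbreviation Neg :: "fm \<Rightarrow> fm" where
  "Neg A \<equiv> Imp A Bot"

primrec qfree :: "fm \<Rightarrow> bool" where
  "qfree (Eq s t) = True"
| "qfree Bot = True"
| "qfree (And A B) = (qfree A \<and> qfree B)"
| "qfree (Or A B) = (qfree A \<and> qfree B)"
| "qfree (Imp A B) = (qfree A \<and> qfree B)"
| "qfree (Forall \<sigma> A) = False"
| "qfree (Exists \<sigma> A) = False"

primrec wrec_free :: "tm \<Rightarrow> bool" and wrec_free_fm :: "fm \<Rightarrow> bool" where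
  "wrec_free (Var i) = True"
| "wrec_free (App s t) = (wrec_free s \<and> wrec_free t)"
| "wrec_free (Lam \<sigma> t) = wrec_free t"
| "wrec_free Zero = True"
| "wrec_free Succ = True"
| "wrec_free (Rec \<rho>) = True"
| "wrec_free (Cond A s t) = (wrec_free_fm A \<and> wrec_free s \<and> wrec_free t)"
| "wrec_free (WRec \<phi> a U i) = False"
| "wrec_free_fm (Eq s t) = (wrec_free s \<and> wrec_free t)"
| "wrec_free_fm Bot = True"
| "wrec_free_fm (And A B) = (wrec_free_fm A \<and> wrec_free_fm B)"
| "wrec_free_fm (Or A B) = (wrec_free_fm A \<and> wrec_free_fm B)"
| "wrec_free_fm (Imp A B) = (wrec_free_fm A \<and> wrec_free_fm B)"
| "wrec_free_fm (Forall \<sigma> A) = wrec_free_fm A"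
| "wrec_free_fm (Exists \<sigma> A) = wrec_free_fm A"

definition up_ren :: "(nat \<Rightarrow> nat) \<Rightarrow> nat \<Rightarrow> nat" where
  "up_ren f i = (case i of 0 \<Rightarrow> 0 | Suc j \<Rightarrow> Suc (f j))"

primrec ren :: "(nat \<Rightarrow> nat) \<Rightarrow> tm \<Rightarrow> tm" and ren_fm :: "(nat \<Rightarrow> nat) \<Rightarrow> fm \<Rightarrow> fm" where
  "ren f (Var i) = Var (f i)"
| "ren f (App s t) = App (ren f s) (ren f t)"
| "ren f (Lam \<sigma> t) = Lam \<sigma> (ren (up_ren f) t)"
| "ren f Zero = Zero"
| "ren f Succ = Succ"
| "ren f (Rec \<rho>) = Rec \<rho>"
| "ren f (Cond A s t) = Cond (ren_fm f A) (ren f s) (ren f t)"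
| "ren f (WRec \<phi> a U i) = WRec \<phi> a U i"
| "ren_fm f (Eq s t) = Eq (ren f s) (ren f t)"
| "ren_fm f Bot = Bot"
| "ren_fm f (And A B) = And (ren_fm f A) (ren_fm f B)"
| "ren_fm f (Or A B) = Or (ren_fm f A) (ren_fm f B)"
| "ren_fm f (Imp A B) = Imp (ren_fm f A) (ren_fm f B)"
| "ren_fm f (Forall \<sigma> A) = Forall \<sigma> (ren_fm (up_ren f) A)"
| "ren_fm f (Exists \<sigma> A) = Exists \<sigma> (ren_fm (up_ren f) A)"

abbreviation lift :: "nat \<Rightarrow> tm \<Rightarrow> tm" where
  "lift k \<equiv> ren (\<lambda>i. i + k)"

abbreviation lift_fm :: "nat \<Rightarrow> fm \<Rightarrow> fm" where
  "lift_fm k \<equiv> ren_fm (\<lambda>i. i + k)"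

definition up_sub :: "(nat \<Rightarrow> tm) \<Rightarrow> nat \<Rightarrow> tm" where
  "up_sub s i = (case i of 0 \<Rightarrow> Var 0 | Suc j \<Rightarrow> lift 1 (s j))"

primrec sub :: "(nat \<Rightarrow> tm) \<Rightarrow> tm \<Rightarrow> tm" and sub_fm :: "(nat \<Rightarrow> tm) \<Rightarrow> fm \<Rightarrow> fm" where
  "sub f (Var i) = f i"
| "sub f (App s t) = App (sub f s) (sub f t)"
| "sub f (Lam \<sigma> t) = Lam \<sigma> (sub (up_sub f) t)"
| "sub f Zero = Zero"
| "sub f Succ = Succ"
| "sub f (Rec \<rho>) = Rec \<rho>"
| "sub f (Cond A s t) = Cond (sub_fm f A) (sub f s) (sub f t)"
| "sub f (WRec \<phi> a U i) = WRec \<phi> a U i"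
| "sub_fm f (Eq s t) = Eq (sub f s) (sub f t)"
| "sub_fm f Bot = Bot"
| "sub_fm f (And A B) = And (sub_fm f A) (sub_fm f B)"
| "sub_fm f (Or A B) = Or (sub_fm f A) (sub_fm f B)"
| "sub_fm f (Imp A B) = Imp (sub_fm f A) (sub_fm f B)"
| "sub_fm f (Forall \<sigma> A) = Forall \<sigma> (sub_fm (up_sub f) A)"
| "sub_fm f (Exists \<sigma> A) = Exists \<sigma> (sub_fm (up_sub f) A)"

text \<open>
  \<open>inst_fm k ts A\<close> is \<open>A(ts)\<close>: if \<open>A\<close> is a formula in context \<open>rev X @ \<Gamma>\<close> and \<open>ts\<close> is a tuple of terms of
  types \<open>X\<close> in context \<open>\<Theta> @ \<Gamma>\<close> with \<open>length \<Theta> = k\<close>, then \<open>inst_fm k ts A\<close> is a formula in context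
  \<open>\<Theta> @ \<Gamma>\<close>.  (If \<open>\<Gamma>\<close> is empty, the value of \<open>k\<close> is immaterial.)
\<close>

definition tuple_sub :: "nat \<Rightarrow> tm list \<Rightarrow> nat \<Rightarrow> tm" where
  "tuple_sub k ts i = (if i < length ts then rev ts ! i else Var (i - length ts + k))"

abbreviation inst :: "nat \<Rightarrow> tm list \<Rightarrow> tm \<Rightarrow> tm" where
  "inst k ts \<equiv> sub (tuple_sub k ts)"

abbreviation inst_fm :: "nat \<Rightarrow> tm list \<Rightarrow> fm \<Rightarrow> fm" where
  "inst_fm k ts \<equiv> sub_fm (tuple_sub k ts)"

text \<open>
  \<open>vars k n\<close> is the tuple of the variables introduced by \<open>n\<close> binders, below which there are \<open>k\<close>
  further binders.
\<close>

definition vars :: "nat \<Rightarrow> nat \<Rightarrow> tm list" where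
  "vars k n = map Var (rev [k..<k + n])"

definition apps :: "tm \<Rightarrow> tm list \<Rightarrow> tm" where
  "apps t ss = foldl App t ss"

definition appt :: "tm list \<Rightarrow> tm list \<Rightarrow> tm list" where
  "appt ts ss = map (\<lambda>t. apps t ss) ts"

definition Lams :: "ty list \<Rightarrow> tm \<Rightarrow> tm" where
  "Lams X t = foldr Lam X t"

definition Foralls :: "ty list \<Rightarrow> fm \<Rightarrow> fm" where
  "Foralls X A = foldr Forall X A"

definition WRecs :: "fm \<Rightarrow> tm list \<Rightarrow> ty list \<Rightarrow> tm list" where
  "WRecs \<phi> a U = map (WRec \<phi> a U) [0..<length U]"

inductive has_type :: "ty list \<Rightarrow> ty list \<Rightarrow> tm \<Rightarrow> ty \<Rightarrow> bool"
  and wff :: "ty list \<Rightarrow> ty list \<Rightarrow> fm \<Rightarrow> bool"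
  for X :: "ty list"
where
  ty_Var: "i < length \<Gamma> \<Longrightarrow> has_type X \<Gamma> (Var i) (\<Gamma> ! i)"
| ty_App: "has_type X \<Gamma> s (Arr \<sigma> \<tau>) \<Longrightarrow> has_type X \<Gamma> t \<sigma> \<Longrightarrow> has_type X \<Gamma> (App s t) \<tau>"
| ty_Lam: "has_type X (\<sigma> # \<Gamma>) t \<tau> \<Longrightarrow> has_type X \<Gamma> (Lam \<sigma> t) (Arr \<sigma> \<tau>)"
| ty_Zero: "has_type X \<Gamma> Zero NatT"
| ty_Succ: "has_type X \<Gamma> Succ (Arr NatT NatT)"
| ty_Rec: "has_type X \<Gamma> (Rec \<rho>) (funs [NatT, \<rho>, funs [\<rho>, NatT] \<rho>] \<rho>)"
| ty_Cond: "qfree A \<Longrightarrow> wff X \<Gamma> A \<Longrightarrow> has_type X \<Gamma> s \<tau> \<Longrightarrow> has_type X \<Gamma> t \<tau> \<Longrightarrow>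
    has_type X \<Gamma> (Cond A s t) \<tau>"
| ty_WRec: "qfree \<phi> \<Longrightarrow> wff X (rev X) \<phi> \<Longrightarrow>
    list_all2 (has_type X []) a (map (funs X) X) \<Longrightarrow> i < length U \<Longrightarrow>
    has_type X \<Gamma> (WRec \<phi> a U i)
      (funs (map (funs X) U @ map (funs (X @ U)) U @ X) (U ! i))"
| wf_Eq: "has_type X \<Gamma> s NatT \<Longrightarrow> has_type X \<Gamma> t NatT \<Longrightarrow> wff X \<Gamma> (Eq s t)"
| wf_Bot: "wff X \<Gamma> Bot"
| wf_And: "wff X \<Gamma> A \<Longrightarrow> wff X \<Gamma> B \<Longrightarrow> wff X \<Gamma> (And A B)"
| wf_Or: "wff X \<Gamma> A \<Longrightarrow> wff X \<Gamma> B \<Longrightarrow> wff X \<Gamma> (Or A B)"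
| wf_Imp: "wff X \<Gamma> A \<Longrightarrow> wff X \<Gamma> B \<Longrightarrow> wff X \<Gamma> (Imp A B)"
| wf_Forall: "wff X (\<sigma> # \<Gamma>) A \<Longrightarrow> wff X \<Gamma> (Forall \<sigma> A)"
| wf_Exists: "wff X (\<sigma> # \<Gamma>) A \<Longrightarrow> wff X \<Gamma> (Exists \<sigma> A)"

text \<open>A tuple of terms of types \<open>map (funs Z) Y\<close> is a tuple \<open>Z \<rightarrow> Y\<close>.\<close>

definition has_types :: "ty list \<Rightarrow> ty list \<Rightarrow> tm list \<Rightarrow> ty list \<Rightarrow> bool" where
  "has_types X \<Gamma> ts Y = list_all2 (has_type X \<Gamma>) ts Y"

text \<open>Only equality between numbers is primitive; at higher types it is defined pointwise.\<close>

primrec eqt :: "ty \<Rightarrow> tm \<Rightarrow> tm \<Rightarrow> fm" where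
  "eqt NatT s t = Eq s t"
| "eqt (Arr \<sigma> \<tau>) s t = Forall \<sigma> (eqt \<tau> (App (lift 1 s) (Var 0)) (App (lift 1 t) (Var 0)))"

text \<open>
  A decidable relation on \<open>X\<close> is a closed term \<open>R : X \<rightarrow> X \<rightarrow> nat\<close>; the value \<open>0\<close> stands for truth.
  As \<open>R\<close> is closed, it needs no lifting under binders.
\<close>

definition prec :: "tm \<Rightarrow> tm list \<Rightarrow> tm list \<Rightarrow> fm" where
  "prec R ss ts = Eq (apps R (ss @ ts)) Zero"

text \<open>
  \<open>prv X R \<Gamma> \<Delta> A\<close>: in the theory for \<open>\<prec>\<close> given by \<open>R\<close> on \<open>X\<close>, the formula \<open>A\<close> is derivable from the
  assumptions \<open>\<Delta>\<close>, all free variables being declared in \<open>\<Gamma>\<close>.  The rules \<open>ER\<close> (quantifier-free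
  extensionality) and \<open>IND\<close> may only be applied to theorems, that is, without open assumptions:
  for \<open>ER\<close>, allowing arbitrary assumptions would amount to full extensionality.
\<close>

inductive prv :: "ty list \<Rightarrow> tm \<Rightarrow> ty list \<Rightarrow> fm list \<Rightarrow> fm \<Rightarrow> bool"
  for X :: "ty list" and R :: tm
where
  Assm: "A \<in> set \<Delta> \<Longrightarrow> wff X \<Gamma> A \<Longrightarrow> prv X R \<Gamma> \<Delta> A"
| BotE: "prv X R \<Gamma> \<Delta> Bot \<Longrightarrow> wff X \<Gamma> A \<Longrightarrow> prv X R \<Gamma> \<Delta> A"
| AndI: "prv X R \<Gamma> \<Delta> A \<Longrightarrow> prv X R \<Gamma> \<Delta> B \<Longrightarrow> prv X R \<Gamma> \<Delta> (And A B)"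
| AndE1: "prv X R \<Gamma> \<Delta> (And A B) \<Longrightarrow> prv X R \<Gamma> \<Delta> A"
| AndE2: "prv X R \<Gamma> \<Delta> (And A B) \<Longrightarrow> prv X R \<Gamma> \<Delta> B"
| OrI1: "prv X R \<Gamma> \<Delta> A \<Longrightarrow> wff X \<Gamma> B \<Longrightarrow> prv X R \<Gamma> \<Delta> (Or A B)"
| OrI2: "prv X R \<Gamma> \<Delta> B \<Longrightarrow> wff X \<Gamma> A \<Longrightarrow> prv X R \<Gamma> \<Delta> (Or A B)"
| OrE: "prv X R \<Gamma> \<Delta> (Or A B) \<Longrightarrow> prv X R \<Gamma> (A # \<Delta>) C \<Longrightarrow> prv X R \<Gamma> (B # \<Delta>) C \<Longrightarrow>
    prv X R \<Gamma> \<Delta> C"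
| ImpI: "wff X \<Gamma> A \<Longrightarrow> prv X R \<Gamma> (A # \<Delta>) B \<Longrightarrow> prv X R \<Gamma> \<Delta> (Imp A B)"
| ImpE: "prv X R \<Gamma> \<Delta> (Imp A B) \<Longrightarrow> prv X R \<Gamma> \<Delta> A \<Longrightarrow> prv X R \<Gamma> \<Delta> B"
| ForallI: "prv X R (\<sigma> # \<Gamma>) (map (lift_fm 1) \<Delta>) A \<Longrightarrow> prv X R \<Gamma> \<Delta> (Forall \<sigma> A)"
| ForallE: "prv X R \<Gamma> \<Delta> (Forall \<sigma> A) \<Longrightarrow> has_type X \<Gamma> t \<sigma> \<Longrightarrow> prv X R \<Gamma> \<Delta> (inst_fm 0 [t] A)"
| ExistsI: "wff X (\<sigma> # \<Gamma>) A \<Longrightarrow> has_type X \<Gamma> t \<sigma> \<Longrightarrow> prv X R \<Gamma> \<Delta> (inst_fm 0 [t] A) \<Longrightarrow>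
    prv X R \<Gamma> \<Delta> (Exists \<sigma> A)"
| ExistsE: "prv X R \<Gamma> \<Delta> (Exists \<sigma> A) \<Longrightarrow> wff X \<Gamma> C \<Longrightarrow>
    prv X R (\<sigma> # \<Gamma>) (A # map (lift_fm 1) \<Delta>) (lift_fm 1 C) \<Longrightarrow> prv X R \<Gamma> \<Delta> C"
| EqRefl: "has_type X \<Gamma> s NatT \<Longrightarrow> prv X R \<Gamma> \<Delta> (Eq s s)"
| EqSym: "prv X R \<Gamma> \<Delta> (Eq s t) \<Longrightarrow> prv X R \<Gamma> \<Delta> (Eq t s)"
| EqTrans: "prv X R \<Gamma> \<Delta> (Eq s t) \<Longrightarrow> prv X R \<Gamma> \<Delta> (Eq t r) \<Longrightarrow> prv X R \<Gamma> \<Delta> (Eq s r)"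
| SuccInj: "prv X R \<Gamma> \<Delta> (Eq (App Succ s) (App Succ t)) \<Longrightarrow> prv X R \<Gamma> \<Delta> (Eq s t)"
| SuccNonzero: "prv X R \<Gamma> \<Delta> (Eq (App Succ s) Zero) \<Longrightarrow> prv X R \<Gamma> \<Delta> Bot"
| Induct: "wff X (NatT # \<Gamma>) A \<Longrightarrow>
    prv X R \<Gamma> \<Delta> (Imp (inst_fm 0 [Zero] A)
      (Imp (Forall NatT (Imp A (inst_fm 1 [App Succ (Var 0)] A))) (Forall NatT A)))"
| Beta: "has_type X (\<sigma> # \<Gamma>) t \<tau> \<Longrightarrow> has_type X \<Gamma> s \<sigma> \<Longrightarrow>
    prv X R \<Gamma> \<Delta> (eqt \<tau> (App (Lam \<sigma> t) s) (inst 0 [s] t))"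
| RecZero: "has_type X \<Gamma> y \<rho> \<Longrightarrow> has_type X \<Gamma> z (funs [\<rho>, NatT] \<rho>) \<Longrightarrow>
    prv X R \<Gamma> \<Delta> (eqt \<rho> (apps (Rec \<rho>) [Zero, y, z]) y)"
| RecSucc: "has_type X \<Gamma> y \<rho> \<Longrightarrow> has_type X \<Gamma> z (funs [\<rho>, NatT] \<rho>) \<Longrightarrow> has_type X \<Gamma> n NatT \<Longrightarrow>
    prv X R \<Gamma> \<Delta> (eqt \<rho> (apps (Rec \<rho>) [App Succ n, y, z]) (apps z [apps (Rec \<rho>) [n, y, z], n]))"
| CondTrue: "qfree A \<Longrightarrow> wff X \<Gamma> A \<Longrightarrow> has_type X \<Gamma> s \<tau> \<Longrightarrow> has_type X \<Gamma> t \<tau> \<Longrightarrow>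
    prv X R \<Gamma> \<Delta> (Imp A (eqt \<tau> (Cond A s t) s))"
| CondFalse: "qfree A \<Longrightarrow> wff X \<Gamma> A \<Longrightarrow> has_type X \<Gamma> s \<tau> \<Longrightarrow> has_type X \<Gamma> t \<tau> \<Longrightarrow>
    prv X R \<Gamma> \<Delta> (Imp (Neg A) (eqt \<tau> (Cond A s t) t))"
| ER: "qfree A \<Longrightarrow> prv X R \<Gamma> [] (Imp A (eqt \<sigma> s t)) \<Longrightarrow>
    has_type X \<Gamma> s \<sigma> \<Longrightarrow> has_type X \<Gamma> t \<sigma> \<Longrightarrow> has_type X (\<sigma> # \<Gamma>) r \<tau> \<Longrightarrow>
    prv X R \<Gamma> [] (Imp A (eqt \<tau> (inst 0 [s] r) (inst 0 [t] r)))"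
| IND: "wff X (rev X @ \<Gamma>) A \<Longrightarrow> n = length X \<Longrightarrow>
    x = vars n n \<Longrightarrow> y = vars 0 n \<Longrightarrow>
    prv X R \<Gamma> [] (Foralls X
      (Imp (Foralls X (Imp (prec R y x) (inst_fm (n + n) y A))) A)) \<Longrightarrow>
    prv X R \<Gamma> [] (Foralls X A)"
| WR: "qfree \<phi> \<Longrightarrow> wff X (rev X) \<phi> \<Longrightarrow> has_types X [] a (map (funs X) X) \<Longrightarrow>
    has_types X \<Gamma> u (map (funs X) U) \<Longrightarrow> has_types X \<Gamma> F (map (funs (X @ U)) U) \<Longrightarrow>
    has_types X \<Gamma> x X \<Longrightarrow> i < length U \<Longrightarrow>
    prv X R \<Gamma> \<Delta> (Imp (Imp (inst_fm 0 x \<phi>) (prec R (appt a x) x))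
      (eqt (U ! i) (apps (WRec \<phi> a U i) (u @ F @ x))
        (Cond (inst_fm 0 x \<phi>)
          (apps (F ! i) (x @ appt (WRecs \<phi> a U) (u @ F @ appt a x)))
          (apps (u ! i) x))))"

text \<open>\<open>D = W (\<lambda>x. x) (\<lambda>x y. y)\<close>, where the result types of \<open>W\<close> are \<open>X\<close>.\<close>

definition while_D :: "ty list \<Rightarrow> fm \<Rightarrow> tm list \<Rightarrow> tm list" where
  "while_D X \<phi> a =
    (let n = length X in
      appt (WRecs \<phi> a X) (map (Lams X) (vars 0 n) @ map (Lams (X @ X)) (vars 0 n)))"

text \<open>
  \<open>B = W (\<lambda>x v. v) (\<lambda>x f v. \<alpha> x (f v))\<close>, where the result types of \<open>W\<close> are \<open>V \<rightarrow> V\<close>.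
\<close>

definition while_B :: "ty list \<Rightarrow> ty list \<Rightarrow> fm \<Rightarrow> tm list \<Rightarrow> tm list \<Rightarrow> tm list" where
  "while_B X V \<phi> a \<alpha> =
    (let n = length X; m = length V; U = map (funs V) V;
         x = vars (m + m) n; f = vars m m; v = vars 0 m
     in appt (WRecs \<phi> a U)
          (map (Lams (X @ V)) v @
           map (Lams (X @ U @ V)) (appt (map (lift (n + m + m)) \<alpha>) (x @ appt f v))))"

end

theory Submission
  imports Defs
begin

text \<open>
  The triple is derived by \<open>IND\<close> applied to
  \<open>A(x) = \<forall>v (P(x, B x v) \<rightarrow> P(D x, v) \<and> \<not> \<phi>(D x))\<close>, by cases on \<open>\<phi>(x)\<close>, which is decidable.  If \<open>\<not> \<phi>(x)\<close>, then
  \<open>D x = x\<close> and \<open>B x v = v\<close>.  If \<open>\<phi>(x)\<close>, then \<open>D x = D (a x)\<close> and \<open>B x v = \<alpha> x (B (a x) v)\<close>, so the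
  given triple at \<open>B (a x) v\<close> leads from \<open>P(x, B x v)\<close> to \<open>P(a x, B (a x) v)\<close>, and the induction
  hypothesis at \<open>a x\<close> finishes.

  Replacing equals inside \<open>P\<close> needs quantifier-free extensionality, where the equation may depend
  only on a quantifier-free formula and on no open assumption.  Since \<open>\<prec>\<close> is decidable,
  \<open>(\<phi>(x) \<rightarrow> a x \<prec> x) \<and> \<phi>(x)\<close> is such a formula, and the equations for \<open>D\<close> and \<open>B\<close> follow from it.
\<close>

section \<open>Renaming and substitution\<close>

lemma up_ren_comp: "(\<lambda>i. up_ren f (up_ren g i)) = up_ren (\<lambda>i. f (g i))"
  by (auto simp: up_ren_def fun_eq_iff split: nat.split)

lemma ren_ren:
  "ren f (ren g t) = ren (\<lambda>i. f (g i)) t"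
  "ren_fm f (ren_fm g A) = ren_fm (\<lambda>i. f (g i)) A"
  by (induction t and A arbitrary: f g and f g rule: tm.induct fm.induct)
    (simp_all add: up_ren_comp)

lemma up_sub_up_ren: "(\<lambda>i. up_sub f (up_ren g i)) = up_sub (\<lambda>i. f (g i))"
  by (auto simp: up_ren_def up_sub_def fun_eq_iff split: nat.split)

lemma sub_ren:
  "sub f (ren g t) = sub (\<lambda>i. f (g i)) t"
  "sub_fm f (ren_fm g A) = sub_fm (\<lambda>i. f (g i)) A"
  by (induction t and A arbitrary: f g and f g rule: tm.induct fm.induct)
    (simp_all add: up_sub_up_ren)

lemma up_ren_up_sub: "(\<lambda>i. ren (up_ren f) (up_sub g i)) = up_sub (\<lambda>i. ren f (g i))"
  by (auto simp: up_ren_def up_sub_def fun_eq_iff ren_ren split: nat.split)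

lemma ren_sub:
  "ren f (sub g t) = sub (\<lambda>i. ren f (g i)) t"
  "ren_fm f (sub_fm g A) = sub_fm (\<lambda>i. ren f (g i)) A"
  by (induction t and A arbitrary: f g and f g rule: tm.induct fm.induct)
    (simp_all add: up_ren_up_sub)

lemma up_sub_up_sub: "(\<lambda>i. sub (up_sub f) (up_sub g i)) = up_sub (\<lambda>i. sub f (g i))"
  by (auto simp: up_sub_def fun_eq_iff sub_ren ren_sub split: nat.split)

lemma sub_sub:
  "sub f (sub g t) = sub (\<lambda>i. sub f (g i)) t"
  "sub_fm f (sub_fm g A) = sub_fm (\<lambda>i. sub f (g i)) A"
  by (induction t and A arbitrary: f g and f g rule: tm.induct fm.induct)
    (simp_all add: up_sub_up_sub)

lemma up_sub_Var: "up_sub Var = Var"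
  by (auto simp: up_sub_def fun_eq_iff split: nat.split)

lemma sub_Var [simp]: "sub Var t = t" "sub_fm Var A = A"
  by (induction t and A rule: tm.induct fm.induct) (simp_all add: up_sub_Var)

lemma ren_eq_sub:
  "ren f t = sub (\<lambda>i. Var (f i)) t"
  "ren_fm f A = sub_fm (\<lambda>i. Var (f i)) A"
  using sub_ren[of Var f] by simp_all

lemma qfree_ren [simp]: "qfree (ren_fm f A) = qfree A"
  by (induction A arbitrary: f rule: fm.induct[where ?P1.0 = "\<lambda>_. True"]) auto

lemma qfree_sub [simp]: "qfree (sub_fm f A) = qfree A"
  by (induction A arbitrary: f rule: fm.induct[where ?P1.0 = "\<lambda>_. True"]) auto

text \<open>\<open>tuple_sub\<close> with an arbitrary tail in place of the shift of the remaining
  variables. In this generality, extending by a further tuple and composing with a substitution stay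
  within the same form. The tuple is reversed because its last component belongs to the innermost
  binder, index \<open>0\<close>.\<close>

definition cons_sub :: "tm list \<Rightarrow> (nat \<Rightarrow> tm) \<Rightarrow> nat \<Rightarrow> tm" where
  "cons_sub ts s i = (if i < length ts then rev ts ! i else s (i - length ts))"

lemma cons_sub_Nil [simp]: "cons_sub [] s = s"
  by (auto simp: cons_sub_def fun_eq_iff)

lemma cons_sub_append: "cons_sub (ts @ us) s = cons_sub us (cons_sub ts s)"
  by (auto simp: cons_sub_def fun_eq_iff nth_append add.commute)

lemma cons_sub_Cons: "cons_sub (t # ts) s = cons_sub ts (cons_sub [t] s)"
  using cons_sub_append[of "[t]" ts s] by simp

lemma cons_sub_add [simp]: "k = length ts \<Longrightarrow> cons_sub ts s (i + k) = s i"
  by (simp add: cons_sub_def)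

lemma tuple_sub_eq: "tuple_sub k ts = cons_sub ts (\<lambda>i. Var (i + k))"
  by (auto simp: cons_sub_def tuple_sub_def fun_eq_iff)

lemma sub_cons_sub: "(\<lambda>i. sub g (cons_sub ts s i)) = cons_sub (map (sub g) ts) (\<lambda>i. sub g (s i))"
  by (auto simp: cons_sub_def fun_eq_iff rev_map)

lemma length_vars [simp]: "length (vars k n) = n"
  by (simp add: vars_def)

lemma nth_vars: "i < n \<Longrightarrow> vars k n ! i = Var (k + (n - Suc i))"
  by (simp add: vars_def rev_nth)

text \<open>Under binders for \<open>X @ V\<close> those of \<open>V\<close> are innermost, so the
  tuple for \<open>X\<close> is the one that carries an offset.\<close>

lemma vars_add: "vars 0 (n + m) = vars m n @ vars 0 m"
  by (rule nth_equalityI) (auto simp: nth_vars nth_append)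

lemma sub_vars_cons [simp]:
  "n = length ts \<Longrightarrow> map (sub (cons_sub ts s)) (vars 0 n) = ts"
  by (rule nth_equalityI) (auto simp: nth_vars cons_sub_def rev_nth)

lemma sub_vars_shift:
  "n = length ts \<Longrightarrow> map (sub (cons_sub ts s)) (vars (k + n) m) = map (sub s) (vars k m)"
  by (rule nth_equalityI) (auto simp: nth_vars cons_sub_def)

lemma sub_vars_ren: "map (sub (\<lambda>i. Var (i + j))) (vars k n) = vars (k + j) n"
  by (rule nth_equalityI) (auto simp: nth_vars)

text \<open>Used to instantiate a universally closed theorem, shifted under \<open>k\<close>
  binders, at the variables of these binders themselves: this returns its original body.\<close>

lemma cons_sub_vars: "cons_sub (vars 0 k) (\<lambda>i. Var (i + k)) = Var"
  by (auto simp: cons_sub_def fun_eq_iff rev_nth nth_vars)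

lemma up_sub_cons: "(\<lambda>i. sub (cons_sub [t] Var) (up_sub s i)) = cons_sub [t] s"
  by (auto simp: up_sub_def fun_eq_iff cons_sub_def sub_ren split: nat.split)

text \<open>Makes \<open>ForallE\<close> and \<open>Beta\<close>, which fill one binder at a time,
  fit parallel substitutions: they can be iterated by prepending one term after another to
  \<open>s\<close>.\<close>

lemma up_sub_inst:
  "inst 0 [t] (sub (up_sub s) r) = sub (cons_sub [t] s) r"
  "inst_fm 0 [t] (sub_fm (up_sub s) A) = sub_fm (cons_sub [t] s) A"
  by (simp_all add: tuple_sub_eq sub_sub up_sub_cons)

lemma inst_lift [simp]: "inst 0 [t] (lift 1 r) = r"
  by (simp add: sub_ren tuple_sub_def)

lemma sub_eqt: "sub_fm f (eqt \<sigma> s t) = eqt \<sigma> (sub f s) (sub f t)"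
proof (induction \<sigma> arbitrary: f s t)
  case (Arr \<sigma> \<tau>)
  then show ?case by (simp add: sub_ren ren_sub up_sub_def)
qed simp

lemma apps_simps [simp]:
  "apps t [] = t" "apps t (s # ss) = apps (App t s) ss"
  "apps t (ss @ us) = apps (apps t ss) us"
  by (simp_all add: apps_def)

lemma sub_apps [simp]: "sub f (apps t ss) = apps (sub f t) (map (sub f) ss)"
  by (induction ss arbitrary: t) auto

lemma length_appt [simp]: "length (appt ts ss) = length ts"
  by (simp add: appt_def)

lemma nth_appt [simp]: "i < length ts \<Longrightarrow> appt ts ss ! i = apps (ts ! i) ss"
  by (simp add: appt_def)

lemma appt_append: "appt ts (ss @ us) = appt (appt ts ss) us"
  by (simp add: appt_def)

lemma sub_appt: "map (sub f) (appt ts ss) = appt (map (sub f) ts) (map (sub f) ss)"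
  by (simp add: appt_def)

lemma length_WRecs [simp]: "length (WRecs \<phi> a U) = length U"
  by (simp add: WRecs_def)

lemma nth_WRecs [simp]: "i < length U \<Longrightarrow> WRecs \<phi> a U ! i = WRec \<phi> a U i"
  by (simp add: WRecs_def)

lemma sub_WRecs [simp]: "map (sub f) (WRecs \<phi> a U) = WRecs \<phi> a U"
  by (simp add: WRecs_def)

lemma Lams_simps [simp]: "Lams [] t = t" "Lams (\<sigma> # X) t = Lam \<sigma> (Lams X t)"
  by (simp_all add: Lams_def)

lemma Foralls_simps [simp]: "Foralls [] A = A" "Foralls (\<sigma> # X) A = Forall \<sigma> (Foralls X A)"
  by (simp_all add: Foralls_def)

lemma Foralls_append: "Foralls (X @ Y) A = Foralls X (Foralls Y A)"
  by (simp add: Foralls_def)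

lemma funs_simps [simp]: "funs [] \<tau> = \<tau>" "funs (\<sigma> # X) \<tau> = Arr \<sigma> (funs X \<tau>)"
  "funs (X @ Y) \<tau> = funs X (funs Y \<tau>)"
  by (simp_all add: funs_def)

section \<open>Typing under renaming and substitution\<close>

definition sub_ty :: "ty list \<Rightarrow> ty list \<Rightarrow> ty list \<Rightarrow> (nat \<Rightarrow> tm) \<Rightarrow> bool" where
  "sub_ty X \<Gamma> \<Gamma>' s \<longleftrightarrow> (\<forall>i < length \<Gamma>. has_type X \<Gamma>' (s i) (\<Gamma> ! i))"

definition ren_ty :: "ty list \<Rightarrow> ty list \<Rightarrow> (nat \<Rightarrow> nat) \<Rightarrow> bool" where
  "ren_ty \<Gamma> \<Gamma>' f \<longleftrightarrow> (\<forall>i < length \<Gamma>. f i < length \<Gamma>' \<and> \<Gamma>' ! f i = \<Gamma> ! i)"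

lemma ren_ty_up: "ren_ty \<Gamma> \<Gamma>' f \<Longrightarrow> ren_ty (\<sigma> # \<Gamma>) (\<sigma> # \<Gamma>') (up_ren f)"
  by (auto simp: ren_ty_def up_ren_def nth_Cons split: nat.split)

lemma ren_ty_ren:
  "has_type X \<Gamma> t \<tau> \<Longrightarrow> ren_ty \<Gamma> \<Gamma>' f \<Longrightarrow> has_type X \<Gamma>' (ren f t) \<tau>"
  "wff X \<Gamma> A \<Longrightarrow> ren_ty \<Gamma> \<Gamma>' f \<Longrightarrow> wff X \<Gamma>' (ren_fm f A)"
proof (induction arbitrary: f \<Gamma>' and f \<Gamma>' rule: has_type_wff.inducts)
  case (ty_Var i \<Gamma>)
  then show ?case by (metis has_type_wff.ty_Var ren.simps(1) ren_ty_def)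
next
  case (ty_App \<Gamma> s \<sigma> \<tau> t)
  then show ?case by (metis has_type_wff.ty_App ren.simps(2))
next
  case (ty_WRec \<phi> a i U \<Gamma>)
  then show ?case
    by (auto intro!: has_type_wff.ty_WRec elim!: list_all2_mono simp del: funs_simps)
qed (auto intro!: has_type_wff.intros simp: ren_ty_up simp del: funs_simps)

lemma lift_ty:
  "has_type X \<Gamma> t \<tau> \<Longrightarrow> k = length \<Theta> \<Longrightarrow> has_type X (\<Theta> @ \<Gamma>) (lift k t) \<tau>"
  "wff X \<Gamma> A \<Longrightarrow> k = length \<Theta> \<Longrightarrow> wff X (\<Theta> @ \<Gamma>) (lift_fm k A)"
  by (auto elim!: ren_ty_ren simp: ren_ty_def nth_append)

lemma lift1_ty: "has_type X \<Gamma> t \<tau> \<Longrightarrow> has_type X (\<sigma> # \<Gamma>) (lift 1 t) \<tau>"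
  using lift_ty(1)[of X \<Gamma> t \<tau> 1 "[\<sigma>]"] by simp

lemma sub_ty_up: "sub_ty X \<Gamma> \<Gamma>' s \<Longrightarrow> sub_ty X (\<sigma> # \<Gamma>) (\<sigma> # \<Gamma>') (up_sub s)"
  unfolding sub_ty_def up_sub_def
  using has_type_wff.ty_Var[of 0 "\<sigma> # \<Gamma>'" X]
  by (auto simp: nth_Cons lift1_ty[simplified] split: nat.split)

lemma sub_ty_sub:
  "has_type X \<Gamma> t \<tau> \<Longrightarrow> sub_ty X \<Gamma> \<Gamma>' s \<Longrightarrow> has_type X \<Gamma>' (sub s t) \<tau>"
  "wff X \<Gamma> A \<Longrightarrow> sub_ty X \<Gamma> \<Gamma>' s \<Longrightarrow> wff X \<Gamma>' (sub_fm s A)"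
proof (induction arbitrary: s \<Gamma>' and s \<Gamma>' rule: has_type_wff.inducts)
  case (ty_Var i \<Gamma>)
  then show ?case by (simp add: sub_ty_def)
next
  case (ty_App \<Gamma> s \<sigma> \<tau> t)
  then show ?case by (metis has_type_wff.ty_App sub.simps(2))
next
  case (ty_WRec \<phi> a i U \<Gamma>)
  then show ?case
    by (auto intro!: has_type_wff.ty_WRec elim!: list_all2_mono simp del: funs_simps)
qed (auto intro!: has_type_wff.intros simp: sub_ty_up simp del: funs_simps)

lemma up_sub_agree:
  "\<forall>i < length \<Gamma>. f i = g i \<Longrightarrow> \<forall>i < length (\<sigma> # \<Gamma>). up_sub f i = up_sub g i"
  by (auto simp: up_sub_def split: nat.split)

text \<open>A well-formed expression contains no variable beyond its context. This yields that
  closed terms are unchanged by substitution and, later, that \<phi> depends on the tuple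
  \<open>x\<close> alone.\<close>

lemma sub_agree:
  "has_type X \<Gamma> t \<tau> \<Longrightarrow> \<forall>i < length \<Gamma>. f i = g i \<Longrightarrow> sub f t = sub g t"
  "wff X \<Gamma> A \<Longrightarrow> \<forall>i < length \<Gamma>. f i = g i \<Longrightarrow> sub_fm f A = sub_fm g A"
proof (induction arbitrary: f g and f g rule: has_type_wff.inducts)
  case (ty_Lam \<sigma> \<Gamma> t \<tau>)
  then show ?case by (metis up_sub_agree sub.simps(3))
next
  case (wf_Forall \<sigma> \<Gamma> A)
  then show ?case by (metis up_sub_agree sub_fm.simps(6))
next
  case (wf_Exists \<sigma> \<Gamma> A)
  then show ?case by (metis up_sub_agree sub_fm.simps(7))
next
  case (ty_App \<Gamma> s \<sigma> \<tau> t)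
  then show ?case by (metis sub.simps(2))
next
  case (ty_Cond A \<Gamma> s \<tau> t)
  then show ?case by (metis sub.simps(7))
next
  case (wf_Eq \<Gamma> s t)
  then show ?case by (metis sub_fm.simps(1))
next
  case (wf_And \<Gamma> A B)
  then show ?case by (metis sub_fm.simps(3))
next
  case (wf_Or \<Gamma> A B)
  then show ?case by (metis sub_fm.simps(4))
next
  case (wf_Imp \<Gamma> A B)
  then show ?case by (metis sub_fm.simps(5))
qed simp_all

lemma sub_closed: "has_type X [] t \<tau> \<Longrightarrow> sub f t = t"
  using sub_agree(1)[of X "[]" t \<tau> f Var] by simp

lemma closed_ty: "has_type X [] t \<tau> \<Longrightarrow> has_type X \<Gamma> t \<tau>"
  using sub_ty_sub(1)[of X "[]" t \<tau> \<Gamma> Var] by (simp add: sub_ty_def)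

section \<open>Derivations with tuples of variables and terms\<close>

lemma has_types_Nil [simp]: "has_types X \<Gamma> [] []"
  by (simp add: has_types_def)

lemma has_types_Cons [simp]:
  "has_types X \<Gamma> (t # ts) (\<sigma> # Y) \<longleftrightarrow> has_type X \<Gamma> t \<sigma> \<and> has_types X \<Gamma> ts Y"
  by (simp add: has_types_def)

lemma has_types_length: "has_types X \<Gamma> ts Y \<Longrightarrow> length ts = length Y"
  by (auto simp: has_types_def list_all2_lengthD)

lemma has_types_nth: "has_types X \<Gamma> ts Y \<Longrightarrow> i < length Y \<Longrightarrow> has_type X \<Gamma> (ts ! i) (Y ! i)"
  by (auto simp: has_types_def list_all2_conv_all_nth)

lemma has_types_append:
  "has_types X \<Gamma> ss Y \<Longrightarrow> has_types X \<Gamma> us Z \<Longrightarrow> has_types X \<Gamma> (ss @ us) (Y @ Z)"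
  by (auto simp: has_types_def intro: list_all2_appendI)

lemma apps_ty:
  "has_type X \<Gamma> t (funs Y \<tau>) \<Longrightarrow> has_types X \<Gamma> ss Y \<Longrightarrow> has_type X \<Gamma> (apps t ss) \<tau>"
  unfolding has_types_def
  by (rotate_tac 1, induction ss Y arbitrary: t rule: list_all2_induct) (auto intro: ty_App)

lemma appt_ty:
  "has_types X \<Gamma> ts (map (funs Y) Z) \<Longrightarrow> has_types X \<Gamma> ss Y \<Longrightarrow> has_types X \<Gamma> (appt ts ss) Z"
  by (auto simp: has_types_def list_all2_conv_all_nth intro!: apps_ty[of _ _ _ Y])

lemma has_types_sub:
  "has_types X \<Gamma> ts Y \<Longrightarrow> sub_ty X \<Gamma> \<Gamma>' s \<Longrightarrow> has_types X \<Gamma>' (map (sub s) ts) Y"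
  by (auto simp: has_types_def list_all2_conv_all_nth intro: sub_ty_sub)

lemma has_types_lift:
  "has_types X \<Gamma> ts Y \<Longrightarrow> k = length \<Theta> \<Longrightarrow> has_types X (\<Theta> @ \<Gamma>) (map (lift k) ts) Y"
  by (auto simp: has_types_def list_all2_conv_all_nth intro: lift_ty)

lemma has_types_closed: "has_types X [] ts Y \<Longrightarrow> has_types X \<Gamma> ts Y"
  by (auto simp: has_types_def list_all2_conv_all_nth intro: closed_ty)

lemma sub_closeds: "has_types X [] ts Y \<Longrightarrow> map (sub f) ts = ts"
  by (auto simp: has_types_def list_all2_conv_all_nth intro!: nth_equalityI sub_closed)

lemma vars_ty: "has_types X (\<Theta> @ rev Y @ \<Gamma>) (vars (length \<Theta>) (length Y)) Y"
proof -
  have "has_type X (\<Theta> @ rev Y @ \<Gamma>) (vars (length \<Theta>) (length Y) ! i) (Y ! i)"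
    if "i < length Y" for i
  proof -
    \<comment> \<open>Binding a tuple from left to right reverses it in the context: component
      \<open>i\<close> sits at the mirrored position \<open>length Y - Suc i\<close>.\<close>
    have "(\<Theta> @ rev Y @ \<Gamma>) ! (length \<Theta> + (length Y - Suc i)) = Y ! i"
      using that nth_append_left[of "length Y - Suc i" "rev Y" \<Gamma>]
      by (simp only: nth_append_length_plus) (simp add: rev_nth)
    then show ?thesis
      using that has_type_wff.ty_Var[of "length \<Theta> + (length Y - Suc i)" "\<Theta> @ rev Y @ \<Gamma>" X]
      by (simp add: nth_vars)
  qed
  then show ?thesis by (auto simp: has_types_def list_all2_conv_all_nth)
qed

lemma sub_ty_cons:
  "has_types X \<Gamma>' ts Y \<Longrightarrow> sub_ty X \<Gamma> \<Gamma>' s \<Longrightarrow> sub_ty X (rev Y @ \<Gamma>) \<Gamma>' (cons_sub ts s)"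
  by (auto simp: sub_ty_def cons_sub_def nth_append has_types_def list_all2_conv_all_nth rev_nth)

lemma sub_ty_Var: "sub_ty X \<Gamma> \<Gamma> Var"
  by (simp add: sub_ty_def ty_Var)

lemma sub_ty_shift: "k = length \<Theta> \<Longrightarrow> sub_ty X \<Gamma> (\<Theta> @ \<Gamma>) (\<lambda>i. Var (i + k))"
  unfolding sub_ty_def
  using has_type_wff.ty_Var[of "_ + length \<Theta>" "\<Theta> @ \<Gamma>" X]
  by (auto simp: nth_append)

lemma Lams_ty: "has_type X (rev Y @ \<Gamma>) t \<tau> \<Longrightarrow> has_type X \<Gamma> (Lams Y t) (funs Y \<tau>)"
  by (induction Y arbitrary: \<Gamma>) (auto intro: ty_Lam)

lemma Foralls_wff: "wff X (rev Y @ \<Gamma>) A \<Longrightarrow> wff X \<Gamma> (Foralls Y A)"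
  by (induction Y arbitrary: \<Gamma>) (auto intro: wf_Forall)

lemma eqt_wff: "has_type X \<Gamma> s \<sigma> \<Longrightarrow> has_type X \<Gamma> t \<sigma> \<Longrightarrow> wff X \<Gamma> (eqt \<sigma> s t)"
proof (induction \<sigma> arbitrary: \<Gamma> s t)
  case NatT
  then show ?case by (simp add: wf_Eq)
next
  case (Arr \<sigma> \<tau>)
  have v: "has_type X (\<sigma> # \<Gamma>) (Var 0) \<sigma>" using ty_Var[of 0 "\<sigma> # \<Gamma>"] by simp
  show ?case unfolding eqt.simps
    by (rule wf_Forall, rule Arr.IH(2); rule ty_App[OF lift1_ty v]) fact+
qed

lemma wf_Neg: "wff X \<Gamma> A \<Longrightarrow> wff X \<Gamma> (Neg A)"
  by (simp add: wf_Imp wf_Bot)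

text \<open>Derivations with open assumptions cannot use \<open>ER\<close> or \<open>IND\<close>, and weakening is not admissible;
  theorems therefore enter such derivations as assumptions, which are discharged here.\<close>

lemma cut:
  assumes "\<And>C. C \<in> set \<Delta> \<Longrightarrow> wff X \<Gamma> C \<and> prv X R \<Gamma> [] C" "prv X R \<Gamma> \<Delta> A"
  shows "prv X R \<Gamma> [] A"
  using assms
proof (induction \<Delta> arbitrary: A)
  case (Cons C \<Delta>)
  then have "prv X R \<Gamma> [] (Imp C A)" by (simp add: ImpI)
  moreover have "prv X R \<Gamma> [] C" using Cons.prems by simp
  ultimately show ?case by (rule ImpE)
qed simp

lemma ForallsI:
  "prv X R (rev Y @ \<Gamma>) (map (lift_fm (length Y)) \<Delta>) A \<Longrightarrow> prv X R \<Gamma> \<Delta> (Foralls Y A)"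
proof (induction Y arbitrary: \<Gamma> \<Delta>)
  case Nil
  then show ?case by (simp add: ren_eq_sub comp_def)
next
  case (Cons \<sigma> Y)
  have "map (lift_fm (length Y)) (map (lift_fm 1) \<Delta>) = map (lift_fm (length (\<sigma> # Y))) \<Delta>"
    by (simp add: ren_ren)
  with Cons.prems have "prv X R (rev Y @ \<sigma> # \<Gamma>) (map (lift_fm (length Y)) (map (lift_fm 1) \<Delta>)) A"
    by (simp only: rev.simps append_assoc append_Cons append_Nil)
  from ForallI[OF Cons.IH[OF this]] show ?case by (simp only: Foralls_simps)
qed

text \<open>The substitution \<open>s\<close> is what makes the induction go through: once the first
  quantifier is instantiated by \<open>t\<close>, the remaining ones are under
  \<open>cons_sub [t] s\<close>, to which the hypothesis applies again.\<close>

lemma ForallsE: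
  "prv X R \<Gamma> \<Delta> (sub_fm s (Foralls Y A)) \<Longrightarrow> has_types X \<Gamma> ts Y \<Longrightarrow>
    prv X R \<Gamma> \<Delta> (sub_fm (cons_sub ts s) A)"
proof (induction Y arbitrary: s ts)
  case Nil
  then show ?case by (auto simp: has_types_def)
next
  case (Cons \<sigma> Y)
  from Cons.prems(2) obtain t us where ts: "ts = t # us" "has_type X \<Gamma> t \<sigma>" "has_types X \<Gamma> us Y"
    by (auto simp: has_types_def list_all2_Cons2)
  from Cons.prems(1) have "prv X R \<Gamma> \<Delta> (Forall \<sigma> (sub_fm (up_sub s) (Foralls Y A)))" by simp
  from ForallE[OF this ts(2)] have "prv X R \<Gamma> \<Delta> (sub_fm (cons_sub [t] s) (Foralls Y A))"
    by (simp only: up_sub_inst)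
  from Cons.IH[OF this ts(3)] show ?case by (simp add: ts(1) cons_sub_Cons[of t us])
qed

section \<open>Equality at higher types and iterated beta reduction\<close>

lemma eqt_refl: "has_type X \<Gamma> s \<sigma> \<Longrightarrow> prv X R \<Gamma> \<Delta> (eqt \<sigma> s s)"
proof (induction \<sigma> arbitrary: \<Gamma> \<Delta> s)
  case (Arr \<sigma> \<tau>)
  have "has_type X (\<sigma> # \<Gamma>) (Var 0) \<sigma>" using ty_Var[of 0 "\<sigma> # \<Gamma>"] by simp
  with Arr show ?case unfolding eqt.simps
    by (intro ForallI Arr.IH(2) ty_App[OF lift1_ty])
qed (simp add: EqRefl)

lemma eqt_app:
  assumes "prv X R \<Gamma> \<Delta> (eqt (Arr \<sigma> \<tau>) s t)" "has_type X \<Gamma> u \<sigma>"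
  shows "prv X R \<Gamma> \<Delta> (eqt \<tau> (App s u) (App t u))"
  using ForallE[OF assms[unfolded eqt.simps]] unfolding sub_eqt
  by (simp add: sub_ren tuple_sub_def)

lemma eqt_apps:
  "prv X R \<Gamma> \<Delta> (eqt (funs Y \<tau>) s t) \<Longrightarrow> has_types X \<Gamma> us Y \<Longrightarrow>
    prv X R \<Gamma> \<Delta> (eqt \<tau> (apps s us) (apps t us))"
proof (induction Y arbitrary: s t us)
  case Nil
  then show ?case by (auto simp: has_types_def)
next
  case (Cons \<sigma> Y)
  from Cons.prems(2) obtain v vs where us: "us = v # vs" "has_type X \<Gamma> v \<sigma>" "has_types X \<Gamma> vs Y"
    by (auto simp: has_types_def list_all2_Cons2)
  show ?case unfolding us apps_simps
    using Cons.prems(1) by (intro Cons.IH eqt_app[of _ _ _ _ \<sigma>] us) simp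
qed

text \<open>Stated as an implication on purpose. At an arrow type the argument moves below a new
  quantifier; a version from derivations to derivations would have to carry the given derivations
  into the larger context, whereas formulas can simply be lifted as assumptions.\<close>

lemma eqt_trans_Imp:
  "has_type X \<Gamma> s \<sigma> \<Longrightarrow> has_type X \<Gamma> t \<sigma> \<Longrightarrow> has_type X \<Gamma> r \<sigma> \<Longrightarrow>
    prv X R \<Gamma> \<Delta> (Imp (eqt \<sigma> s t) (Imp (eqt \<sigma> t r) (eqt \<sigma> s r)))"
proof (induction \<sigma> arbitrary: \<Gamma> \<Delta> s t r)
  case NatT
  then have "wff X \<Gamma> (Eq s t)" "wff X \<Gamma> (Eq t r)" by (simp_all add: wf_Eq)
  then show ?case unfolding eqt.simps by (intro ImpI EqTrans[of _ _ _ _ s t r]) (auto intro: Assm)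
next
  case (Arr \<sigma> \<tau>)
  let ?\<Delta> = "eqt (Arr \<sigma> \<tau>) t r # eqt (Arr \<sigma> \<tau>) s t # \<Delta>"
  let ?\<Delta>' = "map (lift_fm 1) ?\<Delta>"
  have v: "has_type X (\<sigma> # \<Gamma>) (Var 0) \<sigma>" using ty_Var[of 0 "\<sigma> # \<Gamma>"] by simp
  have l: "lift_fm 1 (eqt (Arr \<sigma> \<tau>) p q) = eqt (Arr \<sigma> \<tau>) (lift 1 p) (lift 1 q)" for p q
    unfolding ren_eq_sub sub_eqt ..
  have 1: "prv X R (\<sigma> # \<Gamma>) ?\<Delta>' (eqt \<tau> (App (lift 1 s) (Var 0)) (App (lift 1 t) (Var 0)))"
    by (rule eqt_app[OF _ v], rule Assm) (auto simp only: l list.map set_simps insert_iff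
       intro!: eqt_wff lift1_ty Arr.prems)
  have 2: "prv X R (\<sigma> # \<Gamma>) ?\<Delta>' (eqt \<tau> (App (lift 1 t) (Var 0)) (App (lift 1 r) (Var 0)))"
    by (rule eqt_app[OF _ v], rule Assm) (auto simp only: l list.map set_simps insert_iff
       intro!: eqt_wff lift1_ty Arr.prems)
  have "prv X R (\<sigma> # \<Gamma>) ?\<Delta>' (eqt \<tau> (App (lift 1 s) (Var 0)) (App (lift 1 r) (Var 0)))"
    by (rule ImpE[OF ImpE[OF Arr.IH(2) 1] 2]; rule ty_App[OF lift1_ty v]) fact+
  then have "prv X R \<Gamma> ?\<Delta> (eqt (Arr \<sigma> \<tau>) s r)"
    unfolding eqt.simps(2) [of _ _ s r] by (rule ForallI)
  then show ?case by (intro ImpI eqt_wff Arr.prems)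
qed

lemma eqt_trans:
  "prv X R \<Gamma> \<Delta> (eqt \<sigma> s t) \<Longrightarrow> prv X R \<Gamma> \<Delta> (eqt \<sigma> t r) \<Longrightarrow>
    has_type X \<Gamma> s \<sigma> \<Longrightarrow> has_type X \<Gamma> t \<sigma> \<Longrightarrow> has_type X \<Gamma> r \<sigma> \<Longrightarrow>
    prv X R \<Gamma> \<Delta> (eqt \<sigma> s r)"
  by (meson ImpE eqt_trans_Imp)

text \<open>Each beta step leaves the remaining abstractions under a substitution, hence the
  induction is over \<open>Y\<close> with \<open>s\<close> arbitrary. The single step is an equation
  at type \<open>funs Y \<tau>\<close>, which is applied to the remaining arguments and chained with
  the induction hypothesis.\<close>

lemma betas:
  "has_type X (rev Y @ \<Gamma>) t \<tau> \<Longrightarrow> sub_ty X \<Gamma> \<Gamma>' s \<Longrightarrow> has_types X \<Gamma>' ts Y \<Longrightarrow>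
    prv X R \<Gamma>' \<Delta> (eqt \<tau> (apps (sub s (Lams Y t)) ts) (sub (cons_sub ts s) t))"
proof (induction Y arbitrary: \<Gamma> s ts)
  case Nil
  then show ?case by (auto simp: has_types_def intro: eqt_refl sub_ty_sub)
next
  case (Cons \<sigma> Y)
  from Cons.prems(3) obtain u us
    where ts: "ts = u # us" "has_type X \<Gamma>' u \<sigma>" "has_types X \<Gamma>' us Y"
    by (auto simp: has_types_def list_all2_Cons2)
  have t: "has_type X (rev Y @ \<sigma> # \<Gamma>) t \<tau>" using Cons.prems(1) by simp
  have s: "sub_ty X (\<sigma> # \<Gamma>) \<Gamma>' (cons_sub [u] s)"
    using sub_ty_cons[of X \<Gamma>' "[u]" "[\<sigma>]"] ts(2) Cons.prems(2) by simp
  have L: "has_type X (\<sigma> # \<Gamma>') (sub (up_sub s) (Lams Y t)) (funs Y \<tau>)"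
    by (rule sub_ty_sub(1)[OF Lams_ty[OF t] sub_ty_up]) fact
  have "prv X R \<Gamma>' \<Delta> (eqt (funs Y \<tau>) (App (sub s (Lams (\<sigma> # Y) t)) u) (sub (cons_sub [u] s) (Lams Y t)))"
    using Beta[OF L ts(2)] by (simp only: up_sub_inst Lams_simps sub.simps)
  from eqt_apps[OF this ts(3)]
  have 1: "prv X R \<Gamma>' \<Delta> (eqt \<tau> (apps (sub s (Lams (\<sigma> # Y) t)) ts)
      (apps (sub (cons_sub [u] s) (Lams Y t)) us))" by (simp add: ts(1))
  have 2: "prv X R \<Gamma>' \<Delta> (eqt \<tau> (apps (sub (cons_sub [u] s) (Lams Y t)) us)
      (sub (cons_sub ts s) t))"
    using Cons.IH[OF t s ts(3)] by (simp add: ts(1) cons_sub_Cons[of u us])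
  show ?case
  proof (rule eqt_trans[OF 1 2])
    show "has_type X \<Gamma>' (apps (sub s (Lams (\<sigma> # Y) t)) ts) \<tau>"
      by (rule apps_ty[OF _ Cons.prems(3)], rule sub_ty_sub(1)[OF Lams_ty]) fact+
    show "has_type X \<Gamma>' (apps (sub (cons_sub [u] s) (Lams Y t)) us) \<tau>"
      by (rule apps_ty[OF _ ts(3)], rule sub_ty_sub(1)[OF Lams_ty]) fact+
    show "has_type X \<Gamma>' (sub (cons_sub ts s) t) \<tau>"
      by (rule sub_ty_sub(1)[OF _ sub_ty_cons]) fact+
  qed
qed

section \<open>Decidability and the Leibniz rule for quantifier-free formulas\<close>

lemma up_simps [simp]:
  "up_ren f 0 = 0" "up_ren f (Suc i) = Suc (f i)"
  "up_sub s 0 = Var 0" "up_sub s (Suc i) = lift 1 (s i)"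
  by (simp_all add: up_ren_def up_sub_def)

lemma tuple_sub_single [simp]:
  "tuple_sub k [t] 0 = t" "tuple_sub k [t] (Suc i) = Var (i + k)"
  by (simp_all add: tuple_sub_def)

abbreviation dec :: "fm \<Rightarrow> fm" where
  "dec A \<equiv> Or A (Neg A)"

lemma NatInduct:
  assumes A: "wff X (NatT # \<Gamma>) A" and zero: "prv X R \<Gamma> \<Delta> (inst_fm 0 [Zero] A)"
    and Suc: "prv X R (NatT # \<Gamma>) (A # map (lift_fm 1) \<Delta>) (inst_fm 1 [App Succ (Var 0)] A)"
  shows "prv X R \<Gamma> \<Delta> (Forall NatT A)"
  by (rule ImpE[OF ImpE[OF Induct[OF A] zero] ForallI[OF ImpI[OF A Suc]]])

text \<open>Congruence of the successor comes from \<open>ER\<close>, with the equation itself as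
  quantifier-free premise. The universal closure makes it usable as an assumption inside the
  inductions below.\<close>

lemma Succ_cong:
  "prv X R \<Gamma> [] (Forall NatT (Forall NatT (Imp (Eq (Var (Suc 0)) (Var 0))
    (Eq (App Succ (Var (Suc 0))) (App Succ (Var 0))))))"
proof -
  let ?\<Gamma> = "NatT # NatT # \<Gamma>"
  have v: "has_type X ?\<Gamma> (Var 0) NatT" "has_type X ?\<Gamma> (Var (Suc 0)) NatT"
    "has_type X (NatT # ?\<Gamma>) (Var 0) NatT"
    using ty_Var[of 0 ?\<Gamma> X] ty_Var[of 1 ?\<Gamma> X] ty_Var[of 0 "NatT # ?\<Gamma>" X] by simp_all
  have "prv X R ?\<Gamma> [] (Imp (Eq (Var (Suc 0)) (Var 0)) (eqt NatT (Var (Suc 0)) (Var 0)))"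
    by (simp, rule ImpI[OF _ Assm]) (auto intro: wf_Eq v)
  from ER[OF _ this v(2,1) ty_App[OF ty_Succ v(3)]]
  show ?thesis by (auto intro!: ForallI)
qed

text \<open>Double induction, on the left number outside and on the right one inside. The inductions
  run with open assumptions, so congruence of the successor is carried along as \<open>?C\<close>
  and cut at the end.\<close>

lemma Eq_dec_all:
  "prv X R \<Gamma> [] (Forall NatT (Forall NatT (dec (Eq (Var (Suc 0)) (Var 0)))))"
proof -
  let ?C = "Forall NatT (Forall NatT (Imp (Eq (Var (Suc 0)) (Var 0))
    (Eq (App Succ (Var (Suc 0))) (App Succ (Var 0)))))"
  let ?\<Gamma>1 = "NatT # \<Gamma>" and ?\<Gamma>2 = "NatT # NatT # \<Gamma>"
  have v: "has_type X (NatT # \<Theta>) (Var 0) NatT" "has_type X (\<sigma> # NatT # \<Theta>) (Var (Suc 0)) NatT"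
    "has_type X (\<sigma> # \<tau> # NatT # \<Theta>) (Var (Suc (Suc 0))) NatT" for \<Theta> \<sigma> \<tau>
    using ty_Var[of 0 "NatT # \<Theta>" X] ty_Var[of 1 "\<sigma> # NatT # \<Theta>" X]
      ty_Var[of 2 "\<sigma> # \<tau> # NatT # \<Theta>" X] by (simp_all add: numeral_2_eq_2)
  note wf = has_type_wff.intros(2,4,5,9-) v
  let ?A = "Forall NatT (dec (Eq (Var (Suc 0)) (Var 0)))"
  have zero: "prv X R \<Gamma> [?C] (Forall NatT (dec (Eq Zero (Var 0))))"
  proof (rule NatInduct)
    show "wff X ?\<Gamma>1 (dec (Eq Zero (Var 0)))" by (auto intro!: wf)
    show "prv X R \<Gamma> [?C] (inst_fm 0 [Zero] (dec (Eq Zero (Var 0))))"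
      by (auto intro!: OrI1 EqRefl wf)
    show "prv X R ?\<Gamma>1 (dec (Eq Zero (Var 0)) # map (lift_fm 1) [?C])
      (inst_fm 1 [App Succ (Var 0)] (dec (Eq Zero (Var 0))))"
      by (simp, rule OrI2[OF ImpI[OF _ SuccNonzero[OF EqSym[OF Assm]]]]) (auto intro!: wf)
  qed
  \<comment> \<open>Left number a successor: it differs from \<open>0\<close>; for a successor on
    the right, the outer hypothesis decides equality of the predecessors, and congruence or
    \<open>SuccInj\<close> carries the decision over.\<close>
  have suc: "prv X R ?\<Gamma>1 [?A, ?C] (Forall NatT (dec (Eq (App Succ (Var (Suc 0))) (Var 0))))"
  proof (rule NatInduct)
    let ?B = "dec (Eq (App Succ (Var (Suc 0))) (Var 0))"
    show "wff X (NatT # ?\<Gamma>1) ?B" by (auto intro!: wf)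
    show "prv X R ?\<Gamma>1 [?A, ?C] (inst_fm 0 [Zero] ?B)"
      by (simp, rule OrI2[OF ImpI[OF _ SuccNonzero[OF Assm]]]) (auto intro!: wf)
    \<comment> \<open>Lifting the outer hypothesis past the new variable moves only the index of its
      free left number; \<open>?C\<close> is closed.\<close>
    let ?A' = "Forall NatT (dec (Eq (Var (Suc (Suc 0))) (Var 0)))"
    let ?e = "Eq (Var (Suc 0)) (Var 0)"
    have l: "map (lift_fm 1) [?A, ?C] = [?A', ?C]" by simp
    have C: "prv X R ?\<Gamma>2 \<Delta> (Imp ?e (Eq (App Succ (Var (Suc 0))) (App Succ (Var 0))))"
      if "?C \<in> set \<Delta>" for \<Delta>
    proof -
      have "prv X R ?\<Gamma>2 \<Delta> ?C" using that by (rule Assm) (auto intro!: wf)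
      from ForallE[OF this v(2)]
      have "prv X R ?\<Gamma>2 \<Delta> (Forall NatT (Imp (Eq (Var (Suc (Suc 0))) (Var 0))
        (Eq (App Succ (Var (Suc (Suc 0)))) (App Succ (Var 0)))))" by simp
      from ForallE[OF this v(1)] show ?thesis by simp
    qed
    have "prv X R ?\<Gamma>2 [?B, ?A', ?C] ?A'" by (rule Assm) (auto intro!: wf)
    from ForallE[OF this v(1)] have "prv X R ?\<Gamma>2 [?B, ?A', ?C] (dec ?e)" by simp
    moreover have "prv X R ?\<Gamma>2 [?e, ?B, ?A', ?C] (dec (Eq (App Succ (Var (Suc 0))) (App Succ (Var 0))))"
      by (rule OrI1[OF ImpE[OF C Assm]]) (auto intro!: wf)
    moreover have "prv X R ?\<Gamma>2 [Neg ?e, ?B, ?A', ?C]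
        (dec (Eq (App Succ (Var (Suc 0))) (App Succ (Var 0))))"
      by (rule OrI2[OF ImpI[OF _ ImpE[OF Assm[of "Neg ?e"] SuccInj[OF Assm]]]]) (auto intro!: wf)
    ultimately show "prv X R ?\<Gamma>2 (?B # map (lift_fm 1) [?A, ?C]) (inst_fm 1 [App Succ (Var 0)] ?B)"
      unfolding l by (simp, rule OrE)
  qed
  have "prv X R \<Gamma> [?C] (Forall NatT ?A)"
    by (rule NatInduct) (use zero suc in \<open>auto intro!: wf\<close>)
  moreover have "wff X \<Gamma> ?C" by (auto intro!: wf)
  ultimately show ?thesis by (intro cut[of "[?C]"]) (auto intro: Succ_cong)
qed

lemma Eq_dec:
  assumes "has_type X \<Gamma> s NatT" "has_type X \<Gamma> t NatT"
  shows "prv X R \<Gamma> [] (dec (Eq s t))"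
proof -
  have "prv X R \<Gamma> [] (sub_fm Var (Foralls [NatT, NatT] (dec (Eq (Var (Suc 0)) (Var 0)))))"
    by (simp add: Eq_dec_all)
  from ForallsE[OF this, of "[s, t]"] assms show ?thesis by (simp add: cons_sub_def)
qed

lemma Or_elim_dec:
  assumes "dec A \<in> set \<Delta>" "wff X \<Gamma> A" "prv X R \<Gamma> (A # \<Delta>) C" "prv X R \<Gamma> (Neg A # \<Delta>) C"
  shows "prv X R \<Gamma> \<Delta> C"
  by (rule OrE[OF Assm[of "dec A"]]) (use assms in \<open>auto intro: wf_Or wf_Neg\<close>)

lemma absurd:
  "Neg A \<in> set \<Delta> \<Longrightarrow> wff X \<Gamma> A \<Longrightarrow> prv X R \<Gamma> \<Delta> A \<Longrightarrow> prv X R \<Gamma> \<Delta> Bot"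
  by (rule ImpE[OF Assm[of "Neg A"]]) (auto intro: wf_Neg)

inductive_cases wff_AndE: "wff X \<Gamma> (And A B)"
inductive_cases wff_OrE: "wff X \<Gamma> (Or A B)"
inductive_cases wff_ImpE: "wff X \<Gamma> (Imp A B)"
inductive_cases wff_EqE: "wff X \<Gamma> (Eq s t)"

text \<open>Induction on \<open>A\<close>, starting from decidable equality; each connective is
  settled by its truth table, with decidability of the parts as assumptions that \<open>cut\<close>
  removes. The trivial predicate serves the terms, which are mutually recursive with
  formulas.\<close>

lemma qfree_dec: "qfree A \<Longrightarrow> wff X \<Gamma> A \<Longrightarrow> prv X R \<Gamma> [] (dec A)"
proof (induction A rule: fm.induct[where ?P1.0 = "\<lambda>_. True"])
  case (Eq s t)
  then show ?case by (auto elim!: wff_EqE intro: Eq_dec)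
next
  case Bot
  show ?case by (rule OrI2, rule ImpI) (auto intro: Assm wf_Bot)
next
  case (And A B)
  then have w: "wff X \<Gamma> A" "wff X \<Gamma> B" by (auto elim: wff_AndE)
  have w': "wff X \<Gamma> (And A B)" by fact
  have "prv X R \<Gamma> [dec A, dec B] (dec (And A B))"
  proof (rule Or_elim_dec[OF _ w(1)])
    show "prv X R \<Gamma> [A, dec A, dec B] (dec (And A B))"
    proof (rule Or_elim_dec[OF _ w(2)])
      show "prv X R \<Gamma> [B, A, dec A, dec B] (dec (And A B))"
        by (rule OrI1[OF AndI[OF Assm Assm]]) (auto intro: w w' wf_Neg)
      show "prv X R \<Gamma> [Neg B, A, dec A, dec B] (dec (And A B))"
        by (rule OrI2, rule ImpI, rule w', rule absurd[of B], simp, rule w,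
          rule AndE2[of _ _ _ _ A]) (auto intro: Assm w w')
    qed simp
    show "prv X R \<Gamma> [Neg A, dec A, dec B] (dec (And A B))"
      by (rule OrI2, rule ImpI, rule w', rule absurd[of A], simp, rule w,
        rule AndE1[of _ _ _ _ _ B]) (auto intro: Assm w w')
  qed simp
  with And w show ?case
    by (intro cut[of "[dec A, dec B]"]) (auto intro: wf_Or wf_Neg)
next
  case (Or A B)
  then have w: "wff X \<Gamma> A" "wff X \<Gamma> B" by (auto elim: wff_OrE)
  have w': "wff X \<Gamma> (Or A B)" by fact
  have "prv X R \<Gamma> [dec A, dec B] (dec (Or A B))"
  proof (rule Or_elim_dec[OF _ w(1)])
    show "prv X R \<Gamma> [A, dec A, dec B] (dec (Or A B))"
      by (rule OrI1, rule OrI1) (auto intro: Assm w w' wf_Neg)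
    show "prv X R \<Gamma> [Neg A, dec A, dec B] (dec (Or A B))"
    proof (rule Or_elim_dec[OF _ w(2)])
      show "prv X R \<Gamma> [B, Neg A, dec A, dec B] (dec (Or A B))"
        by (rule OrI1, rule OrI2) (auto intro: Assm w w' wf_Neg)
      show "prv X R \<Gamma> [Neg B, Neg A, dec A, dec B] (dec (Or A B))"
        by (rule OrI2, rule ImpI, rule w', rule OrE[of _ _ _ _ A B], rule Assm, simp, rule w',
            rule absurd[of A], simp, rule w, rule Assm, simp, rule w,
            rule absurd[of B], simp, rule w, rule Assm, simp, rule w, rule w')
    qed simp
  qed simp
  with Or w show ?case
    by (intro cut[of "[dec A, dec B]"]) (auto intro: wf_Or wf_Neg)
next
  case (Imp A B)
  then have w: "wff X \<Gamma> A" "wff X \<Gamma> B" by (auto elim: wff_ImpE)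
  have w': "wff X \<Gamma> (Imp A B)" by fact
  have "prv X R \<Gamma> [dec A, dec B] (dec (Imp A B))"
  proof (rule Or_elim_dec[OF _ w(1)])
    show "prv X R \<Gamma> [A, dec A, dec B] (dec (Imp A B))"
    proof (rule Or_elim_dec[OF _ w(2)])
      show "prv X R \<Gamma> [B, A, dec A, dec B] (dec (Imp A B))"
        by (rule OrI1, rule ImpI) (auto intro: Assm w w' wf_Neg)
      show "prv X R \<Gamma> [Neg B, A, dec A, dec B] (dec (Imp A B))"
        by (rule OrI2, rule ImpI, rule w', rule absurd[of B], simp, rule w,
          rule ImpE[of _ _ _ _ A]) (auto intro: Assm w w')
    qed simp
    show "prv X R \<Gamma> [Neg A, dec A, dec B] (dec (Imp A B))"
      by (rule OrI1, rule ImpI, rule w, rule BotE, rule absurd[of A])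
        (auto intro: Assm w w' wf_Neg)
  qed simp
  with Imp w show ?case
    by (intro cut[of "[dec A, dec B]"]) (auto intro: wf_Or wf_Neg)
qed simp_all

text \<open>Characteristic term of a formula, \<open>0\<close> standing for truth. The rule
  \<open>ER\<close> exchanges equals inside terms only; through these terms it reaches
  quantifier-free formulas.\<close>

abbreviation char_tm :: "fm \<Rightarrow> tm" where
  "char_tm A \<equiv> Cond A Zero (App Succ Zero)"

lemma char_tm_ty: "qfree A \<Longrightarrow> wff X \<Gamma> A \<Longrightarrow> has_type X \<Gamma> (char_tm A) NatT"
  by (auto intro!: ty_Cond ty_Zero ty_App[OF ty_Succ])

text \<open>If \<open>B\<close> failed, its characteristic term would be \<open>1\<close> while that
  of \<open>A\<close> is \<open>0\<close>, so equating them would give \<open>1 = 0\<close>.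
  Decidability of \<open>B\<close> turns this refutation into a proof.\<close>

lemma char_tm_Eq_imp:
  assumes A: "qfree A" "wff X \<Gamma> A" and B: "qfree B" "wff X \<Gamma> B" and H: "wff X \<Gamma> H"
    and eq: "prv X R \<Gamma> [] (Imp H (Eq (char_tm A) (char_tm B)))"
  shows "prv X R \<Gamma> [] (Imp H (Imp A B))"
proof -
  let ?E = "Imp H (Eq (char_tm A) (char_tm B))"
  let ?one = "App Succ Zero"
  have w: "wff X \<Gamma> ?E" by (intro wf_Imp wf_Eq char_tm_ty A B H)
  let ?\<Delta> = "[A, H, ?E, dec B]"
  have one: "has_type X \<Gamma> ?one NatT" by (rule ty_App[OF ty_Succ ty_Zero])
  have "prv X R \<Gamma> ?\<Delta> B"
  proof (rule Or_elim_dec[OF _ B(2)])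
    show "prv X R \<Gamma> (B # ?\<Delta>) B" by (rule Assm) (auto intro: B)
    let ?\<Delta>' = "Neg B # ?\<Delta>"
    have 1: "prv X R \<Gamma> ?\<Delta>' (Eq (char_tm A) Zero)"
      using ImpE[OF CondTrue[OF A ty_Zero one] Assm[of A ?\<Delta>']] A by simp
    have 2: "prv X R \<Gamma> ?\<Delta>' (Eq (char_tm B) ?one)"
      using ImpE[OF CondFalse[OF B ty_Zero one] Assm[of "Neg B" ?\<Delta>']] B by (simp add: wf_Neg)
    have 3: "prv X R \<Gamma> ?\<Delta>' (Eq (char_tm A) (char_tm B))"
      by (rule ImpE[of _ _ _ _ H]) (auto intro: Assm w H)
    have "prv X R \<Gamma> ?\<Delta>' (Eq ?one Zero)"
      by (rule EqTrans[OF EqSym[OF 2] EqTrans[OF EqSym[OF 3] 1]])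
    then show "prv X R \<Gamma> ?\<Delta>' B" by (rule BotE[OF SuccNonzero B(2)])
  qed simp
  then have "prv X R \<Gamma> [?E, dec B] (Imp H (Imp A B))" by (intro ImpI A H)
  then show ?thesis
    by (rule cut[rotated]) (auto intro: w eq qfree_dec B wf_Or wf_Neg)
qed

lemma eqt_trans_under:
  assumes "prv X R \<Gamma> [] (Imp H (eqt \<sigma> s t))" "prv X R \<Gamma> [] (Imp H (eqt \<sigma> t r))"
    and H: "wff X \<Gamma> H"
    and ty: "has_type X \<Gamma> s \<sigma>" "has_type X \<Gamma> t \<sigma>" "has_type X \<Gamma> r \<sigma>"
  shows "prv X R \<Gamma> [] (Imp H (eqt \<sigma> s r))"
proof (rule cut)
  let ?\<Delta> = "[Imp H (eqt \<sigma> s t), Imp H (eqt \<sigma> t r)]"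
  have w: "wff X \<Gamma> (Imp H (eqt \<sigma> s t))" "wff X \<Gamma> (Imp H (eqt \<sigma> t r))"
    by (intro wf_Imp eqt_wff H ty)+
  show "C \<in> set ?\<Delta> \<Longrightarrow> wff X \<Gamma> C \<and> prv X R \<Gamma> [] C" for C
    using assms w by auto
  have "prv X R \<Gamma> (H # ?\<Delta>) (eqt \<sigma> s t)" "prv X R \<Gamma> (H # ?\<Delta>) (eqt \<sigma> t r)"
    by (rule ImpE[of _ _ _ _ H]; auto intro: Assm w H)+
  then show "prv X R \<Gamma> ?\<Delta> (Imp H (eqt \<sigma> s r))"
    by (intro ImpI H) (rule eqt_trans[OF _ _ ty])
qed

text \<open>The rule \<open>ER\<close> changes a single variable; two parallel substitutions are connected by the
  substitutions that agree with \<open>g\<close> below \<open>k\<close> and with \<open>f\<close> from \<open>k\<close> on.\<close>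

lemma ER_sub:
  assumes H: "qfree H" "wff X \<Gamma>' H" and f: "sub_ty X \<Gamma> \<Gamma>' f" and g: "sub_ty X \<Gamma> \<Gamma>' g"
    and eq: "\<And>i. i < length \<Gamma> \<Longrightarrow> prv X R \<Gamma>' [] (Imp H (eqt (\<Gamma> ! i) (f i) (g i)))"
    and r: "has_type X \<Gamma> r \<tau>"
  shows "prv X R \<Gamma>' [] (Imp H (eqt \<tau> (sub f r) (sub g r)))"
proof -
  define h where "h k i = (if i < k then g i else f i)" for k i
  have h: "sub_ty X \<Gamma> \<Gamma>' (h k)" for k using f g by (auto simp: h_def sub_ty_def)
  have "prv X R \<Gamma>' [] (Imp H (eqt \<tau> (sub f r) (sub (h k) r)))" if "k \<le> length \<Gamma>" for k
    using that
  proof (induction k)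
    case 0
    have "h 0 = f" by (simp add: h_def fun_eq_iff)
    show ?case unfolding \<open>h 0 = f\<close> by (intro ImpI H eqt_refl sub_ty_sub(1)[OF r f])
  next
    case (Suc k)
    let ?\<sigma> = "\<Gamma> ! k"
    \<comment> \<open>Here the \<open>k\<close>-th variable is freed: \<open>?s\<close> turns it
      into a fresh variable \<open>0\<close> and treats all others as \<open>h k\<close> does.
      Putting \<open>f k\<close> for the fresh variable gives \<open>h k\<close>, putting
      \<open>g k\<close> gives \<open>h (Suc k)\<close>, so one application of \<open>ER\<close>
      makes the step.\<close>
    let ?s = "\<lambda>i. if i = k then Var 0 else lift 1 (h k i)"
    have k: "k < length \<Gamma>" using Suc.prems by simp
    have v: "has_type X (?\<sigma> # \<Gamma>') (Var 0) ?\<sigma>" using ty_Var[of 0 "?\<sigma> # \<Gamma>'" X] by simp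
    have "has_type X (?\<sigma> # \<Gamma>') (?s i) (\<Gamma> ! i)" if "i < length \<Gamma>" for i
      using v h[of k] that by (simp only: sub_ty_def lift1_ty split: if_split) simp
    then have "sub_ty X \<Gamma> (?\<sigma> # \<Gamma>') ?s" by (simp add: sub_ty_def)
    from sub_ty_sub(1)[OF r this] have r': "has_type X (?\<sigma> # \<Gamma>') (sub ?s r) \<tau>" .
    have fg: "has_type X \<Gamma>' (f k) ?\<sigma>" "has_type X \<Gamma>' (g k) ?\<sigma>"
      using f g k by (auto simp: sub_ty_def)
    have "(\<lambda>i. inst 0 [f k] (?s i)) = h k"
      by (auto simp only: fun_eq_iff inst_lift split: if_split) (simp_all add: h_def)
    moreover have "(\<lambda>i. inst 0 [g k] (?s i)) = h (Suc k)"
      by (auto simp only: fun_eq_iff inst_lift split: if_split) (simp_all add: h_def)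
    ultimately have "prv X R \<Gamma>' [] (Imp H (eqt \<tau> (sub (h k) r) (sub (h (Suc k)) r)))"
      using ER[OF H(1) eq[OF k] fg r'] by (simp only: sub_sub)
    then show ?case
      using Suc by (intro eqt_trans_under[OF Suc.IH] H sub_ty_sub(1)[OF r] f h) auto
  qed
  from this[of "length \<Gamma>"] sub_agree(1)[OF r, of "h (length \<Gamma>)" g]
  show ?thesis by (simp add: h_def)
qed

text \<open>\<open>ER_sub\<close> equates the characteristic terms of the two instances of
  \<open>Q\<close>, which gives one implication; the converse follows by symmetry of the numerical
  equation.\<close>

lemma Leibniz:
  assumes H: "qfree H" "wff X \<Gamma>' H" and f: "sub_ty X \<Gamma> \<Gamma>' f" and g: "sub_ty X \<Gamma> \<Gamma>' g"
    and eq: "\<And>i. i < length \<Gamma> \<Longrightarrow> prv X R \<Gamma>' [] (Imp H (eqt (\<Gamma> ! i) (f i) (g i)))"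
    and Q: "qfree Q" "wff X \<Gamma> Q"
  shows "prv X R \<Gamma>' [] (Imp H (Imp (sub_fm f Q) (sub_fm g Q)))" (is ?thesis1)
    and "prv X R \<Gamma>' [] (Imp H (Imp (sub_fm g Q) (sub_fm f Q)))" (is ?thesis2)
proof -
  have w: "wff X \<Gamma>' (sub_fm f Q)" "wff X \<Gamma>' (sub_fm g Q)"
    using sub_ty_sub(2)[OF Q(2)] f g by auto
  let ?cf = "char_tm (sub_fm f Q)" and ?cg = "char_tm (sub_fm g Q)"
  have 1: "prv X R \<Gamma>' [] (Imp H (Eq ?cf ?cg))"
    using ER_sub[OF H f g eq char_tm_ty[OF Q]] by simp
  then show ?thesis1
    by (intro char_tm_Eq_imp) (auto intro: H Q w)
  have c: "wff X \<Gamma>' (Imp H (Eq ?cf ?cg))"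
    by (auto intro!: wf_Imp wf_Eq char_tm_ty H Q w)
  have "prv X R \<Gamma>' [Imp H (Eq ?cf ?cg)] (Imp H (Eq ?cg ?cf))"
    by (rule ImpI[OF H(2) EqSym], rule ImpE[of _ _ _ _ H]) (auto intro: Assm c H)
  then have "prv X R \<Gamma>' [] (Imp H (Eq ?cg ?cf))"
    by (rule cut[rotated]) (use 1 c in auto)
  then show ?thesis2
    by (intro char_tm_Eq_imp) (auto intro: H Q w)
qed

lemma Leibniz_tuple:
  assumes H: "qfree H" "wff X \<Gamma>' H" and s: "sub_ty X \<Gamma> \<Gamma>' s"
    and ts: "has_types X \<Gamma>' ts Y" and us: "has_types X \<Gamma>' us Y"
    and eq: "\<And>i. i < length Y \<Longrightarrow> prv X R \<Gamma>' [H] (eqt (Y ! i) (ts ! i) (us ! i))"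
    and Q: "qfree Q" "wff X (rev Y @ \<Gamma>) Q"
  shows "prv X R \<Gamma>' [] (Imp H (Imp (sub_fm (cons_sub ts s) Q) (sub_fm (cons_sub us s) Q)))" (is ?thesis1)
    and "prv X R \<Gamma>' [] (Imp H (Imp (sub_fm (cons_sub us s) Q) (sub_fm (cons_sub ts s) Q)))" (is ?thesis2)
proof -
  have "prv X R \<Gamma>' [] (Imp H (eqt ((rev Y @ \<Gamma>) ! i) (cons_sub ts s i) (cons_sub us s i)))"
    if i: "i < length (rev Y @ \<Gamma>)" for i
  proof (cases "i < length Y")
    case True
    then have "length Y - Suc i < length Y" by simp
    from eq[OF this] True show ?thesis
      using ts us by (auto dest!: has_types_length intro!: ImpI H simp: cons_sub_def nth_append rev_nth)
  next
    case False
    with i s show ?thesis using ts us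
      by (auto dest!: has_types_length intro!: ImpI H eqt_refl simp: cons_sub_def nth_append sub_ty_def)
  qed
  from Leibniz[OF H sub_ty_cons[OF ts s] sub_ty_cons[OF us s] this Q]
  show ?thesis1 ?thesis2 by auto
qed

text \<open>The two blocks of arguments of \<open>P\<close> are changed by equations from different
  sources in the while rule; this form takes them separately.\<close>

lemma Leibniz_tuple_append:
  assumes H: "qfree H" "wff X \<Gamma>' H" and s: "sub_ty X \<Gamma> \<Gamma>' s"
    and ts: "has_types X \<Gamma>' ts Y" and us: "has_types X \<Gamma>' us Y"
    and ts': "has_types X \<Gamma>' ts' Z" and us': "has_types X \<Gamma>' us' Z"
    and eq: "\<And>i. i < length Y \<Longrightarrow> prv X R \<Gamma>' [H] (eqt (Y ! i) (ts ! i) (us ! i))"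
    and eq': "\<And>i. i < length Z \<Longrightarrow> prv X R \<Gamma>' [H] (eqt (Z ! i) (ts' ! i) (us' ! i))"
    and Q: "qfree Q" "wff X (rev (Y @ Z) @ \<Gamma>) Q"
  shows "prv X R \<Gamma>' [] (Imp H
      (Imp (sub_fm (cons_sub (ts @ ts') s) Q) (sub_fm (cons_sub (us @ us') s) Q)))"
    and "prv X R \<Gamma>' [] (Imp H
      (Imp (sub_fm (cons_sub (us @ us') s) Q) (sub_fm (cons_sub (ts @ ts') s) Q)))"
proof -
  have "prv X R \<Gamma>' [H] (eqt ((Y @ Z) ! i) ((ts @ ts') ! i) ((us @ us') ! i))"
    if "i < length (Y @ Z)" for i
    using that eq[of i] eq'[of "i - length Y"] has_types_length[OF ts] has_types_length[OF us]
    by (auto simp: nth_append)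
  from Leibniz_tuple[OF H s has_types_append[OF ts ts'] has_types_append[OF us us'] this Q]
  show "prv X R \<Gamma>' [] (Imp H
      (Imp (sub_fm (cons_sub (ts @ ts') s) Q) (sub_fm (cons_sub (us @ us') s) Q)))"
    and "prv X R \<Gamma>' [] (Imp H
      (Imp (sub_fm (cons_sub (us @ us') s) Q) (sub_fm (cons_sub (ts @ ts') s) Q)))" by auto
qed

section \<open>Computation rules for the while recursors\<close>

locale while_theory =
  fixes X :: "ty list" and R :: tm and \<phi> :: fm and a :: "tm list"
  assumes R: "has_type X [] R (funs (X @ X) NatT)"
    and \<phi>: "qfree \<phi>" "wff X (rev X) \<phi>"
    and a: "has_types X [] a (map (funs X) X)"
begin

definition phi :: "tm list \<Rightarrow> fm" where
  "phi x = inst_fm 0 x \<phi>"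

text \<open>The premise of the axiom \<open>WR\<close> together with the true case of its
  conditional, packed into a quantifier-free formula: under it the recursion unfolds, and it may
  serve as the premise in \<open>ER\<close>.\<close>

definition step_hyp :: "tm list \<Rightarrow> fm" where
  "step_hyp x = And (Imp (phi x) (prec R (appt a x) x)) (phi x)"

text \<open>\<phi> has no variables besides those filled by \<open>x\<close>, so the tail
  \<open>s\<close> leaves no trace.\<close>

lemma sub_phi: "length x = length X \<Longrightarrow> sub_fm (cons_sub x s) \<phi> = phi x"
  unfolding phi_def tuple_sub_eq by (rule sub_agree(2)[OF \<phi>(2)]) (simp add: cons_sub_def)

lemma phi_sub: "length x = length X \<Longrightarrow> sub_fm s (phi x) = phi (map (sub s) x)"
  unfolding phi_def tuple_sub_eq sub_sub sub_cons_sub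
  by (simp add: sub_phi)

lemma a_ty: "has_types X \<Gamma> x X \<Longrightarrow> has_types X \<Gamma> (appt a x) X"
  by (rule appt_ty[OF has_types_closed[OF a]])

lemma prec_wff: "has_types X \<Gamma> x X \<Longrightarrow> has_types X \<Gamma> y X \<Longrightarrow> wff X \<Gamma> (prec R x y)"
  unfolding prec_def by (intro wf_Eq apps_ty[OF closed_ty[OF R]] has_types_append ty_Zero)

lemma sub_prec: "sub_fm s (prec R x y) = prec R (map (sub s) x) (map (sub s) y)"
  by (simp add: prec_def sub_closed[OF R])

lemma phi_wff: "has_types X \<Gamma> x X \<Longrightarrow> wff X \<Gamma> (phi x)"
  unfolding phi_def tuple_sub_eq
  using sub_ty_sub(2)[OF \<phi>(2), of \<Gamma>] sub_ty_cons[of X \<Gamma> x X "[]"] by (auto simp: sub_ty_def)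

lemma phi_qfree: "qfree (phi x)"
  by (simp add: phi_def \<phi>)

lemma step_hyp_wff: "has_types X \<Gamma> x X \<Longrightarrow> wff X \<Gamma> (step_hyp x)"
  unfolding step_hyp_def by (intro wf_And wf_Imp phi_wff prec_wff a_ty)

lemma step_hyp_qfree: "qfree (step_hyp x)"
  by (simp add: step_hyp_def phi_qfree prec_def)

section \<open>Unfolding the recursor for arbitrary tuples \<open>u\<close> and
  \<open>F\<close>\<close>

context
  fixes \<Gamma> U :: "ty list" and u F :: "tm list" and W :: "tm list"
  assumes u: "has_types X \<Gamma> u (map (funs X) U)" and F: "has_types X \<Gamma> F (map (funs (X @ U)) U)"
  defines "W \<equiv> appt (WRecs \<phi> a U) (u @ F)"
begin

lemma W_ty: "has_types X \<Gamma> W (map (funs X) U)"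
proof -
  have "has_types X \<Gamma> (WRecs \<phi> a U)
      (map (funs (map (funs X) U @ map (funs (X @ U)) U)) (map (funs X) U))"
    using ty_WRec[OF \<phi> a[unfolded has_types_def], of _ U \<Gamma>]
    by (auto simp: has_types_def list_all2_conv_all_nth)
  then show ?thesis unfolding W_def by (rule appt_ty) (intro has_types_append u F)
qed

context
  fixes x :: "tm list"
  assumes x: "has_types X \<Gamma> x X"
begin

lemma W_step_ty: "has_types X \<Gamma> (appt F (x @ appt W (appt a x))) U"
  by (rule appt_ty[OF F]) (intro has_types_append x appt_ty[OF W_ty] a_ty)

lemma W_eq:
  assumes i: "i < length U" and hyp: "prv X R \<Gamma> \<Delta> (Imp (phi x) (prec R (appt a x) x))"
  shows "prv X R \<Gamma> \<Delta> (eqt (U ! i) (apps (W ! i) x)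
    (Cond (phi x) (apps (F ! i) (x @ appt W (appt a x))) (apps (u ! i) x)))"
  using ImpE[OF WR[OF \<phi> a u F x i] hyp[unfolded phi_def]] i
  by (simp add: W_def phi_def appt_append)

lemma W_tys:
  assumes i: "i < length U"
  shows "has_type X \<Gamma> (apps (W ! i) x) (U ! i)"
    "has_type X \<Gamma> (apps (F ! i) (x @ appt W (appt a x))) (U ! i)"
    "has_type X \<Gamma> (apps (u ! i) x) (U ! i)"
  using i has_types_nth[OF appt_ty[OF W_ty x], of i] has_types_nth[OF W_step_ty, of i]
    has_types_nth[OF appt_ty[OF u x], of i] u F
  by (auto dest!: has_types_length simp: W_def)

lemma Cond_ty:
  assumes i: "i < length U"
  shows "has_type X \<Gamma> (Cond (phi x) (apps (F ! i) (x @ appt W (appt a x))) (apps (u ! i) x)) (U ! i)"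
  by (intro ty_Cond phi_qfree phi_wff x W_tys i)

lemma W_true:
  assumes i: "i < length U"
  shows "prv X R \<Gamma> [step_hyp x]
    (eqt (U ! i) (apps (W ! i) x) (apps (F ! i) (x @ appt W (appt a x))))"
proof -
  have h: "prv X R \<Gamma> [step_hyp x] (And (Imp (phi x) (prec R (appt a x) x)) (phi x))"
    unfolding step_hyp_def[symmetric] by (rule Assm) (auto intro: step_hyp_wff x)
  show ?thesis
    by (rule eqt_trans[OF W_eq[OF i AndE1[OF h]] ImpE[OF CondTrue AndE2[OF h]]])
      (intro phi_qfree phi_wff x W_tys i Cond_ty)+
qed

text \<open>When \<phi> fails at \<open>x\<close>, the premise of \<open>WR\<close> holds vacuously,
  so the axiom applies without any descent.\<close>

lemma W_false:
  assumes i: "i < length U"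
  shows "prv X R \<Gamma> [Neg (phi x)] (eqt (U ! i) (apps (W ! i) x) (apps (u ! i) x))"
proof -
  have w: "wff X \<Gamma> (phi x)" by (rule phi_wff[OF x])
  have "prv X R \<Gamma> [Neg (phi x)] (Imp (phi x) (prec R (appt a x) x))"
    by (rule ImpI[OF w BotE[OF absurd]]) (auto intro: Assm w prec_wff a_ty x)
  moreover have "prv X R \<Gamma> [Neg (phi x)] (Neg (phi x))"
    by (rule Assm) (auto intro: w wf_Neg)
  ultimately show ?thesis
    by (intro eqt_trans[OF W_eq[OF i] ImpE[OF CondFalse]] phi_qfree w W_tys i Cond_ty)
qed

end

end

section \<open>The recursor \<open>while_D\<close>\<close>

lemma D_init_ty: "has_types X \<Gamma> (map (Lams X) (vars 0 (length X))) (map (funs X) X)"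
  using vars_ty[of X "[]" X \<Gamma>]
  by (auto simp: has_types_def list_all2_conv_all_nth intro!: Lams_ty)

lemma D_step_ty: "has_types X \<Gamma> (map (Lams (X @ X)) (vars 0 (length X))) (map (funs (X @ X)) X)"
  using vars_ty[of X "[]" X "rev X @ \<Gamma>"]
  by (auto simp: has_types_def list_all2_conv_all_nth simp del: funs_simps intro!: Lams_ty)

lemma D_eq: "while_D X \<phi> a = appt (WRecs \<phi> a X)
    (map (Lams X) (vars 0 (length X)) @ map (Lams (X @ X)) (vars 0 (length X)))"
  by (simp add: while_D_def Let_def)

lemma D_ty: "has_types X \<Gamma> (while_D X \<phi> a) (map (funs X) X)"
  unfolding D_eq by (rule W_ty[OF D_init_ty D_step_ty])

lemma D_true:
  assumes x: "has_types X \<Gamma> x X" and i: "i < length X"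
  shows "prv X R \<Gamma> [step_hyp x] (eqt (X ! i) (appt (while_D X \<phi> a) x ! i)
    (appt (while_D X \<phi> a) (appt a x) ! i))"
proof -
  let ?D = "while_D X \<phi> a" and ?F = "map (Lams (X @ X)) (vars 0 (length X))"
  let ?y = "appt ?D (appt a x)"
  have y: "has_types X \<Gamma> ?y X" by (rule appt_ty[OF D_ty a_ty[OF x]])
  have xy: "has_types X \<Gamma> (x @ ?y) (X @ X)" by (rule has_types_append[OF x y])
  have l: "length ?D = length X" "length x = length X" "length ?y = length X"
    using has_types_length[OF D_ty] has_types_length[OF x] by auto
  have "prv X R \<Gamma> [step_hyp x] (eqt (X ! i) (apps (?D ! i) x) (apps (?F ! i) (x @ ?y)))"
    using W_true[OF D_init_ty D_step_ty x i] by (simp only: D_eq)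
  \<comment> \<open>The step function of \<open>D\<close> returns its second block of arguments,
    which is innermost and hence has indices from \<open>0\<close>; beta reduction therefore leaves
    the recursive value \<open>?y\<close>.\<close>
  moreover have "prv X R \<Gamma> [step_hyp x] (eqt (X ! i) (apps (?F ! i) (x @ ?y)) (?y ! i))"
  proof -
    have "has_type X (rev (X @ X) @ \<Gamma>) (vars 0 (length X) ! i) (X ! i)"
      using has_types_nth[OF vars_ty[of X "[]" X "rev X @ \<Gamma>"] i] by simp
    moreover have "sub (cons_sub (x @ ?y) Var) (vars 0 (length X) ! i) =
        map (sub (cons_sub ?y (cons_sub x Var))) (vars 0 (length X)) ! i"
      using i by (simp add: cons_sub_append)
    ultimately show ?thesis
      using betas[OF _ sub_ty_Var xy, of "vars 0 (length X) ! i" "X ! i" R] i l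
      by (simp only: sub_Var) simp
  qed
  moreover have "has_type X \<Gamma> (apps (?F ! i) (x @ ?y)) (X ! i)"
    using has_types_nth[OF appt_ty[OF D_step_ty xy] i] i by simp
  moreover have "has_type X \<Gamma> (apps (?D ! i) x) (X ! i)"
    using has_types_nth[OF appt_ty[OF D_ty x] i] i l by simp
  ultimately have "prv X R \<Gamma> [step_hyp x] (eqt (X ! i) (apps (?D ! i) x) (?y ! i))"
    by - (rule eqt_trans[of _ _ _ _ _ _ "apps (?F ! i) (x @ ?y)"];
      (assumption | intro has_types_nth[OF y] i))
  then show ?thesis using i l by simp
qed

lemma D_false:
  assumes x: "has_types X \<Gamma> x X" and i: "i < length X"
  shows "prv X R \<Gamma> [Neg (phi x)] (eqt (X ! i) (appt (while_D X \<phi> a) x ! i) (x ! i))"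
proof -
  let ?D = "while_D X \<phi> a" and ?u = "map (Lams X) (vars 0 (length X))"
  have l: "length ?D = length X" "length x = length X"
    using has_types_length[OF D_ty] has_types_length[OF x] by auto
  have "prv X R \<Gamma> [Neg (phi x)] (eqt (X ! i) (apps (?D ! i) x) (apps (?u ! i) x))"
    using W_false[OF D_init_ty D_step_ty x i] by (simp only: D_eq)
  moreover have "prv X R \<Gamma> [Neg (phi x)] (eqt (X ! i) (apps (?u ! i) x) (x ! i))"
  proof -
    have "has_type X (rev X @ \<Gamma>) (vars 0 (length X) ! i) (X ! i)"
      using has_types_nth[OF vars_ty[of X "[]" X "\<Gamma>"] i] by simp
    moreover have "sub (cons_sub x Var) (vars 0 (length X) ! i) =
        map (sub (cons_sub x Var)) (vars 0 (length X)) ! i"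
      using i by simp
    ultimately show ?thesis
      using betas[OF _ sub_ty_Var x, of "vars 0 (length X) ! i" "X ! i" R] i l
      by (simp only: sub_Var) simp
  qed
  moreover have "has_type X \<Gamma> (apps (?u ! i) x) (X ! i)"
    using has_types_nth[OF appt_ty[OF D_init_ty x] i] i by simp
  moreover have "has_type X \<Gamma> (apps (?D ! i) x) (X ! i)"
    using has_types_nth[OF appt_ty[OF D_ty x] i] i l by simp
  ultimately have "prv X R \<Gamma> [Neg (phi x)] (eqt (X ! i) (apps (?D ! i) x) (x ! i))"
    by - (rule eqt_trans[of _ _ _ _ _ _ "apps (?u ! i) x"];
      (assumption | intro has_types_nth[OF x] i))
  then show ?thesis using i l by simp
qed

section \<open>The recursor \<open>while_B\<close>, under a substitution for its parameters\<close>

context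
  fixes \<Gamma> \<Gamma>' V U :: "ty list" and \<alpha> u F B \<alpha>' u' F' B' x v :: "tm list" and s :: "nat \<Rightarrow> tm"
  assumes \<alpha>: "has_types X \<Gamma> \<alpha> (map (funs (X @ V)) V)"
    and s: "sub_ty X \<Gamma> \<Gamma>' s"
    and x: "has_types X \<Gamma>' x X" and v: "has_types X \<Gamma>' v V"
  defines "U \<equiv> map (funs V) V"
    and "u \<equiv> vars 0 (length V)"
    and "F \<equiv> appt (map (lift (length X + length V + length V)) \<alpha>)
      (vars (length V + length V) (length X) @ appt (vars (length V) (length V)) (vars 0 (length V)))"
    and "B \<equiv> while_B X V \<phi> a \<alpha>"
    and "\<alpha>' \<equiv> map (sub s) \<alpha>"
  defines "B' \<equiv> map (sub s) B"
    and "u' \<equiv> map (\<lambda>t. sub s (Lams (X @ V) t)) u"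
    and "F' \<equiv> map (\<lambda>t. sub s (Lams (X @ U @ V) t)) F"
begin

text \<open>Since \<alpha> may mention the parameters in \<Gamma>, \<open>B\<close> may be open and
  has to be shifted below binders. All facts are therefore about its image \<open>B'\<close> under
  \<open>s\<close>; the recursion constants are fixed by \<open>s\<close>, so \<open>B'\<close> is
  again a recursion, with starting terms \<open>u'\<close> and step terms \<open>F'\<close>.\<close>

lemma B_eq: "B' = appt (WRecs \<phi> a U) (u' @ F')"
  by (simp add: B'_def B_def while_B_def Let_def sub_appt U_def u_def F_def u'_def F'_def comp_def)

lemma u_ty: "has_types X (rev V @ \<Theta>) u V"
  using vars_ty[of X "[]" V \<Theta>] by (simp add: u_def)

lemma B_init_ty: "has_types X \<Gamma>' u' (map (funs X) U)"
  using u_ty[of "rev X @ \<Gamma>"] Lams_ty[of X "X @ V" \<Gamma>]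
  by (auto simp: has_types_def list_all2_conv_all_nth u'_def U_def intro!: sub_ty_sub(1)[OF _ s])

lemma F_ty: "has_types X (rev V @ rev U @ rev X @ \<Gamma>) F V"
  unfolding F_def
proof (rule appt_ty)
  show "has_types X (rev V @ rev U @ rev X @ \<Gamma>) (map (lift (length X + length V + length V)) \<alpha>)
      (map (funs (X @ V)) V)"
    using has_types_lift[OF \<alpha>, of "length X + length V + length V" "rev V @ rev U @ rev X"]
    by (simp add: U_def)
  show "has_types X (rev V @ rev U @ rev X @ \<Gamma>)
      (vars (length V + length V) (length X) @ appt (vars (length V) (length V)) (vars 0 (length V)))
      (X @ V)"
    using vars_ty[of X "rev V @ rev U" X \<Gamma>] vars_ty[of X "rev V" U "rev X @ \<Gamma>"]
      vars_ty[of X "[]" V "rev U @ rev X @ \<Gamma>"]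
    by (intro has_types_append appt_ty[of _ _ _ V]) (simp_all add: U_def)
qed

lemma B_step_ty: "has_types X \<Gamma>' F' (map (funs (X @ U)) U)"
  using F_ty Lams_ty[of X "X @ U @ V" \<Gamma>]
  by (auto simp: has_types_def list_all2_conv_all_nth F'_def U_def intro!: sub_ty_sub(1)[OF _ s])

lemma B_ty: "has_types X \<Gamma>' B' (map (funs (X @ V)) V)"
proof -
  have "map (funs X) U = map (funs (X @ V)) V" by (simp add: U_def)
  then show ?thesis using W_ty[OF B_init_ty B_step_ty] by (simp only: B_eq)
qed

lemma B_len: "length B' = length V"
  using has_types_length[OF B_ty] by simp

text \<open>The values of this recursion are functions from \<open>V\<close> to \<open>V\<close>: it
  is unfolded at \<open>x\<close> as an equation of functions and applied to \<open>v\<close>; then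
  the step term is reduced on the three blocks \<open>x\<close>, recursive value and
  \<open>v\<close> at once.\<close>

lemma B_true:
  assumes i: "i < length V"
  shows "prv X R \<Gamma>' [step_hyp x] (eqt (V ! i) (appt B' (x @ v) ! i)
    (appt \<alpha>' (x @ appt B' (appt a x @ v)) ! i))"
proof -
  let ?f = "appt B' (appt a x)"
  have iU: "i < length U" using i by (simp add: U_def)
  have U: "U ! i = funs V (V ! i)" using i by (simp add: U_def)
  have B: "has_types X \<Gamma>' B' (map (funs X) U)"
    unfolding B_eq by (rule W_ty[OF B_init_ty B_step_ty])
  have f: "has_types X \<Gamma>' ?f U" by (rule appt_ty[OF B a_ty[OF x]])
  have xfv: "has_types X \<Gamma>' (x @ ?f @ v) (X @ U @ V)" by (intro has_types_append x f v)
  have l: "length x = length X" "length ?f = length V" "length v = length V" "length F = length V"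
    "length \<alpha> = length V"
    using has_types_length[OF x] has_types_length[OF f] has_types_length[OF v]
      has_types_length[OF F_ty] has_types_length[OF \<alpha>] by (auto simp: U_def)
  have "prv X R \<Gamma>' [step_hyp x] (eqt (funs V (V ! i)) (apps (B' ! i) x) (apps (F' ! i) (x @ ?f)))"
    using W_true[OF B_init_ty B_step_ty x iU] by (simp only: B_eq U)
  from eqt_apps[OF this v]
  have "prv X R \<Gamma>' [step_hyp x] (eqt (V ! i) (appt B' (x @ v) ! i) (apps (F' ! i) (x @ ?f @ v)))"
    using i by (simp add: B_len)
  moreover have "prv X R \<Gamma>' [step_hyp x] (eqt (V ! i) (apps (F' ! i) (x @ ?f @ v))
    (appt \<alpha>' (x @ appt B' (appt a x @ v)) ! i))"
  proof -
    let ?s = "cons_sub (x @ ?f @ v) s"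
    \<comment> \<open>Of the three blocks, \<open>v\<close> is innermost, then the function, then
      \<open>x\<close>; the lift of \<alpha> by their total length is exactly undone, leaving
      \<open>s\<close> on \<alpha>.\<close>
    have "map (sub ?s) F = appt \<alpha>' (x @ appt ?f v)"
    proof -
      have 1: "map (sub ?s) (map (lift (length X + length V + length V)) \<alpha>) = \<alpha>'"
        using l by (simp add: \<alpha>'_def sub_ren)
      have 2: "map (sub ?s) (vars 0 (length V)) = v"
        using l by (simp add: cons_sub_append)
      have 3: "map (sub ?s) (vars (length V) (length V)) = ?f"
        using l sub_vars_shift[of "length V" v "cons_sub ?f (cons_sub x s)" 0 "length V"]
        by (simp add: cons_sub_append)
      have 4: "map (sub ?s) (vars (length V + length V) (length X)) = x"
        using l sub_vars_shift[of "length V" v "cons_sub ?f (cons_sub x s)" "length V" "length X"]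
          sub_vars_shift[of "length V" ?f "cons_sub x s" 0 "length X"]
        by (simp add: cons_sub_append)
      show ?thesis unfolding F_def sub_appt map_append 1 2 3 4 ..
    qed
    then have "sub ?s (F ! i) = appt \<alpha>' (x @ appt B' (appt a x @ v)) ! i"
      using i l by (metis appt_append nth_map)
    moreover have "has_type X (rev (X @ U @ V) @ \<Gamma>) (F ! i) (V ! i)"
      using has_types_nth[OF F_ty i] by simp
    ultimately show ?thesis
      using betas[OF _ s xfv, of "F ! i" "V ! i" R "[step_hyp x]"] i l by (simp add: F'_def)
  qed
  moreover have "has_type X \<Gamma>' (apps (F' ! i) (x @ ?f @ v)) (V ! i)"
    using has_types_nth[OF appt_ty[OF appt_ty[OF B_step_ty has_types_append[OF x f], unfolded U_def] v] i] i l
    by (simp add: F'_def)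
  moreover have "has_types X \<Gamma>' \<alpha>' (map (funs (X @ V)) V)"
    unfolding \<alpha>'_def by (rule has_types_sub[OF \<alpha> s])
  moreover have "has_types X \<Gamma>' (appt B' (appt a x @ v)) V"
    by (intro appt_ty[OF B_ty] has_types_append a_ty x v)
  ultimately show ?thesis
    by - (rule eqt_trans[of _ _ _ _ _ _ "apps (F' ! i) (x @ ?f @ v)"];
      (assumption | intro has_types_nth[OF _ i]
      appt_ty[OF B_ty] appt_ty[of _ _ \<alpha>' "X @ V"] has_types_append x v a_ty))
qed

lemma B_false:
  assumes i: "i < length V"
  shows "prv X R \<Gamma>' [Neg (phi x)] (eqt (V ! i) (appt B' (x @ v) ! i) (v ! i))"
proof -
  have iU: "i < length U" using i by (simp add: U_def)
  have U: "U ! i = funs V (V ! i)" using i by (simp add: U_def)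
  have xv: "has_types X \<Gamma>' (x @ v) (X @ V)" by (intro has_types_append x v)
  have l: "length x = length X" "length v = length V"
    using has_types_length[OF x] has_types_length[OF v] by auto
  have "prv X R \<Gamma>' [Neg (phi x)] (eqt (funs V (V ! i)) (apps (B' ! i) x) (apps (u' ! i) x))"
    using W_false[OF B_init_ty B_step_ty x iU] by (simp only: B_eq U)
  from eqt_apps[OF this v]
  have "prv X R \<Gamma>' [Neg (phi x)] (eqt (V ! i) (appt B' (x @ v) ! i) (apps (u' ! i) (x @ v)))"
    using i by (simp add: B_len)
  moreover have "prv X R \<Gamma>' [Neg (phi x)] (eqt (V ! i) (apps (u' ! i) (x @ v)) (v ! i))"
  proof -
    have "map (sub (cons_sub (x @ v) s)) u = v"
      using l by (simp add: u_def cons_sub_append)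
    then have "sub (cons_sub (x @ v) s) (u ! i) = v ! i"
      using i l by (metis nth_map length_map)
    moreover have "has_type X (rev (X @ V) @ \<Gamma>) (u ! i) (V ! i)"
      using has_types_nth[OF u_ty i] by simp
    ultimately show ?thesis
      using betas[OF _ s xv, of "u ! i" "V ! i" R "[Neg (phi x)]"] i l by (simp add: u'_def u_def)
  qed
  moreover have "has_type X \<Gamma>' (apps (u' ! i) (x @ v)) (V ! i)"
    using has_types_nth[OF appt_ty[OF appt_ty[OF B_init_ty x, unfolded U_def] v] i] i l
    by (simp add: u'_def u_def)
  ultimately show ?thesis
    by - (rule eqt_trans[of _ _ _ _ _ _ "apps (u' ! i) (x @ v)" "v ! i"];
      (assumption | intro has_types_nth[OF _ i] v appt_ty[OF B_ty] has_types_append x))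
qed

end

end

section \<open>The while rule\<close>

theorem theorem6:
  fixes X V \<Gamma> :: "ty list" and R :: tm and \<phi> P :: fm and a \<alpha> :: "tm list"
  defines "n \<equiv> length X" and "m \<equiv> length V"
  defines "D \<equiv> while_D X \<phi> a" and "B \<equiv> while_B X V \<phi> a \<alpha>"
  defines "x \<equiv> vars m n" and "v \<equiv> vars 0 m"
  assumes R: "has_type X [] R (funs (X @ X) NatT)" "wrec_free R"
    and \<phi>: "qfree \<phi>" "wff X (rev X) \<phi>"
    and P: "qfree P" "wff X (rev (X @ V) @ \<Gamma>) P"
    and a: "has_types X [] a (map (funs X) X)"
    and \<alpha>: "has_types X \<Gamma> \<alpha> (map (funs (X @ V)) V)"
    and triple: "prv X R \<Gamma> [] (Foralls (X @ V)
      (Imp (And (inst_fm (n + m) (x @ appt (map (lift (n + m)) \<alpha>) (x @ v)) P)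
                (inst_fm (n + m) x \<phi>))
           (inst_fm (n + m) (appt a x @ v) P)))"
    and decreasing: "prv X R \<Gamma> [] (Foralls X
      (Imp (inst_fm n (vars 0 n) \<phi>) (prec R (appt a (vars 0 n)) (vars 0 n))))"
  shows "prv X R \<Gamma> [] (Foralls (X @ V)
      (Imp (inst_fm (n + m) (x @ appt (map (lift (n + m)) B) (x @ v)) P)
           (And (inst_fm (n + m) (appt D x @ v) P)
                (Neg (inst_fm (n + m) (appt D x) \<phi>)))))"
proof -
  interpret while_theory X R \<phi> a by unfold_locales fact+
  \<comment> \<open>The argument is carried out in the context of the variables \<open>x\<close>,
    \<open>v\<close> and the parameters; \<open>?sh\<close> moves the parameters there.\<close>
  let ?sh = "\<lambda>i. Var (i + (n + m))" and ?\<Gamma> = "rev (X @ V) @ \<Gamma>"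
  define B' where "B' = map (sub ?sh) B"
  define \<alpha>' where "\<alpha>' = map (sub ?sh) \<alpha>"
  define p where "p y w = sub_fm (cons_sub (y @ w) ?sh) P" for y w
  define Q where "Q y w = And (p y w) (Neg (phi y))" for y w
  have sh: "sub_ty X \<Gamma> ?\<Gamma> ?sh" by (rule sub_ty_shift) (simp add: n_def m_def)
  have x: "has_types X ?\<Gamma> x X"
    using vars_ty[of X "rev V" X \<Gamma>] by (simp add: x_def n_def m_def)
  have v: "has_types X ?\<Gamma> v V"
    using vars_ty[of X "[]" V "rev X @ \<Gamma>"] by (simp add: v_def m_def)
  have \<alpha>'_ty: "has_types X ?\<Gamma> \<alpha>' (map (funs (X @ V)) V)"
    unfolding \<alpha>'_def by (rule has_types_sub[OF \<alpha> sh])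
  have B'_ty: "has_types X ?\<Gamma> B' (map (funs (X @ V)) V)"
    unfolding B'_def B_def by (rule B_ty[OF \<alpha> sh x v])
  have xv: "x @ v = vars 0 (n + m)" by (simp add: x_def v_def vars_add)
  have len: "length x = n" "length v = m" "length a = n" "length D = n"
    using has_types_length[OF a] has_types_length[OF D_ty]
    by (simp_all add: x_def v_def n_def D_def)
  note lens = len has_types_length[OF \<alpha>'_ty] has_types_length[OF B'_ty] n_def[symmetric] m_def[symmetric]
  have p_wff: "wff X ?\<Gamma> (p y w)" if "has_types X ?\<Gamma> y X" "has_types X ?\<Gamma> w V" for y w
    unfolding p_def by (rule sub_ty_sub(2)[OF P(2) sub_ty_cons[OF has_types_append[OF that] sh]])
  have ax: "has_types X ?\<Gamma> (appt a x) X" by (rule a_ty[OF x])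
  have Bx: "has_types X ?\<Gamma> (appt B' (x @ v)) V" and Bax: "has_types X ?\<Gamma> (appt B' (appt a x @ v)) V"
    by (intro appt_ty[OF B'_ty] has_types_append x v ax)+
  have \<alpha>x: "has_types X ?\<Gamma> (appt \<alpha>' (x @ w)) V" if "has_types X ?\<Gamma> w V" for w
    by (intro appt_ty[OF \<alpha>'_ty] has_types_append x that)
  have Dx: "has_types X ?\<Gamma> (appt D x) X" "has_types X ?\<Gamma> (appt D (appt a x)) X"
    unfolding D_def by (intro appt_ty[OF D_ty] x ax)+
  have Q_wff: "wff X ?\<Gamma> (Q y w)" if "has_types X ?\<Gamma> y X" "has_types X ?\<Gamma> w V" for y w
    unfolding Q_def by (intro wf_And wf_Neg p_wff phi_wff that)

  let ?T = "Imp (And (p x (appt \<alpha>' (x @ v))) (phi x)) (p (appt a x) v)"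
  let ?K = "Imp (p x (appt B' (x @ v))) (Q (appt D x) v)"
  let ?d = "Imp (phi (vars 0 n)) (prec R (appt a (vars 0 n)) (vars 0 n))"
  have p_inst: "inst_fm (n + m) (y @ w) P = p y w" for y w
    by (simp add: p_def tuple_sub_eq)
  have phi_inst: "inst_fm k y \<phi> = phi y" if "length y = n" for k y
    using that by (simp add: tuple_sub_eq sub_phi n_def)
  have lift_eq: "map (lift (n + m)) ts = map (sub ?sh) ts" for ts
    by (simp add: ren_eq_sub)
  have T: "prv X R \<Gamma> [] (Foralls (X @ V) ?T)"
    using triple unfolding lift_eq \<alpha>'_def[symmetric] p_inst by (simp add: phi_inst lens)
  have d: "prv X R \<Gamma> [] (Foralls X ?d)"
    using decreasing by (simp add: phi_inst)
  have sub_p: "sub_fm (cons_sub (y @ w) ?sh) (p y' w') =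
      p (map (sub (cons_sub (y @ w) ?sh)) y') (map (sub (cons_sub (y @ w) ?sh)) w')"
    if "length y = n" "length w = m" for y w y' w'
    unfolding p_def sub_sub sub_cons_sub using that by simp

  \<comment> \<open>The conclusion as one quantifier-free formula in the variables \<open>x\<close>,
    \<open>v\<close>, so that exchanging \<open>D (a x)\<close> or \<open>x\<close> for
    \<open>D x\<close> alters both conjuncts in a single use of the Leibniz rule.\<close>
  let ?Q = "And P (Neg (phi x))"
  have Qq: "qfree ?Q" "wff X ?\<Gamma> ?Q"
    using P wf_And[OF P(2) wf_Neg[OF phi_wff[OF x]]] by (simp_all add: phi_qfree)
  have sub_x: "map (sub (cons_sub (y @ w) ?sh)) x = y" if "length y = n" "length w = m" for y w
    using that sub_vars_shift[of m w "cons_sub y ?sh" 0 n] by (simp add: cons_sub_append x_def)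
  have sub_v: "map (sub (cons_sub (y @ w) ?sh)) v = w" if "length y = n" "length w = m" for y w
    using that by (simp add: cons_sub_append v_def)

  \<comment> \<open>Four transports, all proved without assumptions as \<open>ER\<close> demands:
    \<open>?C1\<close> and \<open>?C2\<close> for the case of \<phi>, \<open>?N1\<close> and
    \<open>?N2\<close> for its negation. In each case one moves the conclusion along the equations
    for \<open>D\<close>, the other the hypothesis along those for \<open>B\<close>.\<close>
  let ?C1 = "Imp (step_hyp x) (Imp (Q (appt D (appt a x)) v) (Q (appt D x) v))"
  have C1: "prv X R ?\<Gamma> [] ?C1"
    using Leibniz_tuple_append(2)[OF step_hyp_qfree step_hyp_wff[OF x] sh Dx v v
        D_true[OF x, folded D_def] eqt_refl[OF has_types_nth[OF v]] Qq]
    by (simp add: Q_def p_def phi_sub sub_x lens)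
  let ?C2 = "Imp (step_hyp x)
    (Imp (p x (appt B' (x @ v))) (p x (appt \<alpha>' (x @ appt B' (appt a x @ v)))))"
  have C2: "prv X R ?\<Gamma> [] ?C2" unfolding p_def
    using Leibniz_tuple_append(1)[OF step_hyp_qfree step_hyp_wff[OF x] sh x x Bx \<alpha>x[OF Bax]
        eqt_refl[OF has_types_nth[OF x]]
        B_true[OF \<alpha> sh x v, folded B_def, folded B'_def \<alpha>'_def] P] .
  have np: "qfree (Neg (phi x))" "wff X ?\<Gamma> (Neg (phi x))"
    using wf_Neg[OF phi_wff[OF x]] by (simp_all add: phi_qfree)
  let ?N1 = "Imp (Neg (phi x)) (Imp (Q x v) (Q (appt D x) v))"
  have N1: "prv X R ?\<Gamma> [] ?N1"
    using Leibniz_tuple_append(2)[OF np sh Dx(1) x v v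
        D_false[OF x, folded D_def] eqt_refl[OF has_types_nth[OF v]] Qq]
    by (simp add: Q_def p_def phi_sub sub_x lens)
  let ?N2 = "Imp (Neg (phi x)) (Imp (p x (appt B' (x @ v))) (p x v))"
  have N2: "prv X R ?\<Gamma> [] ?N2" unfolding p_def
    using Leibniz_tuple_append(1)[OF np sh x x Bx v eqt_refl[OF has_types_nth[OF x]]
        B_false[OF \<alpha> sh x v, folded B_def, folded B'_def] P] .
  have dec_phi: "prv X R ?\<Gamma> [] (dec (phi x))"
    by (rule qfree_dec[OF phi_qfree phi_wff[OF x]])

  let ?Cs = "[?C1, ?C2, ?N1, ?N2, dec (phi x)]"
  \<comment> \<open>All theorems needed below, closed so as to live over \<Gamma> alone: they can be
    assumed before \<open>x\<close> and \<open>v\<close> are introduced, instantiated inside, and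
    cut once the binders are closed again.\<close>
  let ?\<Theta> = "Foralls (X @ V) ?T # Foralls X ?d # map (Foralls (X @ V)) ?Cs"
  have Cs_wff: "wff X ?\<Gamma> C" if "C \<in> set ?Cs" for C
    using that by (auto intro!: wf_Imp wf_Or wf_Neg wf_Bot step_hyp_wff phi_wff p_wff Q_wff x v ax Bx Bax \<alpha>x Dx
      simp del: rev_append append_assoc)
  have Cs_prv: "prv X R ?\<Gamma> [] C" if "C \<in> set ?Cs" for C
    using that C1 C2 N1 N2 dec_phi by (auto simp del: rev_append append_assoc)
  have y: "has_types X (rev X @ \<Theta>) (vars 0 n) X" for \<Theta>
    using vars_ty[of X "[]" X \<Theta>] by (simp add: n_def)
  have T_wff: "wff X \<Gamma> (Foralls (X @ V) ?T)"
    by (intro Foralls_wff wf_Imp wf_And p_wff phi_wff x v ax \<alpha>x)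
  have d_wff: "wff X \<Gamma> (Foralls X ?d)"
    by (intro Foralls_wff wf_Imp prec_wff phi_wff a_ty y)
  have \<Theta>: "wff X \<Gamma> C \<and> prv X R \<Gamma> [] C" if "C \<in> set ?\<Theta>" for C
  proof -
    have "wff X \<Gamma> (Foralls (X @ V) C) \<and> prv X R \<Gamma> [] (Foralls (X @ V) C)" if "C \<in> set ?Cs" for C
      using Cs_wff[OF that] Cs_prv[OF that] by (auto intro!: Foralls_wff ForallsI simp del: rev_append append_assoc)
    with that show ?thesis using T d T_wff d_wff by auto
  qed

  let ?A = "Foralls V ?K"
  \<comment> \<open>The induction hypothesis exactly as \<open>IND\<close> builds it: the new tuple
    is innermost, at \<open>vars 0 n\<close>, and pushes the outer one to
    \<open>vars n n\<close>.\<close>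
  let ?IH = "Foralls X (Imp (prec R (vars 0 n) (vars n n)) (inst_fm (n + n) (vars 0 n) ?A))"
  have K_wff: "wff X ?\<Gamma> ?K" by (intro wf_Imp p_wff Q_wff x v Bx Dx)
  have A_wff: "wff X (rev X @ \<Gamma>) ?A" by (rule Foralls_wff) (use K_wff in simp)
  have IH_wff: "wff X (rev X @ \<Gamma>) ?IH"
  proof (intro Foralls_wff wf_Imp prec_wff y)
    show "has_types X (rev X @ rev X @ \<Gamma>) (vars n n) X"
      using vars_ty[of X "rev X" X \<Gamma>] by (simp add: n_def)
    show "wff X (rev X @ rev X @ \<Gamma>) (inst_fm (n + n) (vars 0 n) ?A)"
      unfolding tuple_sub_eq
      by (rule sub_ty_sub(2)[OF A_wff sub_ty_cons[OF y]])
        (use sub_ty_shift[of "n + n" "rev X @ rev X" X \<Gamma>] in \<open>simp add: n_def\<close>)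
  qed
  \<comment> \<open>The assumptions in force after introducing \<open>x\<close> and then
    \<open>v\<close>; on \<open>?\<Theta>\<close> the two successive lifts combine to
    \<open>?sh\<close>.\<close>
  let ?\<Delta> = "p x (appt B' (x @ v)) # lift_fm m ?IH # map (lift_fm m) (map (lift_fm n) ?\<Theta>)"
  have lift_mn: "lift_fm m (lift_fm n C) = sub_fm ?sh C" for C
    unfolding ren_ren by (simp only: ren_eq_sub add.assoc)
  have main: "prv X R ?\<Gamma> ?\<Delta> (Q (appt D x) v)"
  proof -
    have \<Theta>_hyp: "prv X R ?\<Gamma> \<Delta> (sub_fm ?sh C)" if "C \<in> set ?\<Theta>" "set ?\<Delta> \<subseteq> set \<Delta>" for C \<Delta>
    proof (rule Assm)
      have "sub_fm ?sh C \<in> set (map (lift_fm m) (map (lift_fm n) ?\<Theta>))"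
        using that(1) unfolding lift_mn[symmetric] set_map by (intro imageI)
      then show "sub_fm ?sh C \<in> set \<Delta>" using that(2) by (auto simp del: list.map)
      show "wff X ?\<Gamma> (sub_fm ?sh C)" using \<Theta>[OF that(1)] sub_ty_sub(2)[OF _ sh] by blast
    qed
    have hyp: "prv X R ?\<Gamma> \<Delta> C" if "C \<in> set ?Cs" "set ?\<Delta> \<subseteq> set \<Delta>" for C \<Delta>
    proof -
      have "Foralls (X @ V) C \<in> set ?\<Theta>" using that(1) by auto
      from ForallsE[OF \<Theta>_hyp[OF this that(2)] has_types_append[OF x v]]
      show ?thesis by (simp add: xv cons_sub_vars)
    qed
    \<comment> \<open>The triple is kept with \<open>w\<close> arbitrary, because it is needed at
      \<open>B (a x) v\<close> rather than at \<open>v\<close>.\<close>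
    have T_hyp: "prv X R ?\<Gamma> \<Delta>
        (Imp (And (p x (appt \<alpha>' (x @ w))) (phi x)) (p (appt a x) w))"
      if w: "has_types X ?\<Gamma> w V" and \<Delta>: "set ?\<Delta> \<subseteq> set \<Delta>" for w \<Delta>
    proof -
      have l: "length w = m" using has_types_length[OF w] by (simp add: m_def)
      have "map (sub (cons_sub (x @ w) ?sh)) \<alpha>' = \<alpha>'"
        using l by (simp add: \<alpha>'_def sub_sub lens)
      then show ?thesis
        using ForallsE[OF \<Theta>_hyp[OF _ \<Delta>] has_types_append[OF x w], of ?T] l
        by (simp add: sub_p phi_sub sub_x sub_v sub_appt sub_closeds[OF a] lens)
    qed
    have d_hyp: "prv X R ?\<Gamma> \<Delta> (Imp (phi x) (prec R (appt a x) x))" if \<Delta>: "set ?\<Delta> \<subseteq> set \<Delta>" for \<Delta>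
      using ForallsE[OF \<Theta>_hyp[OF _ \<Delta>] x, of ?d]
      by (simp add: phi_sub sub_prec sub_appt sub_closeds[OF a] lens)
    have IH_hyp: "prv X R ?\<Gamma> \<Delta>
        (Imp (p (appt a x) (appt B' (appt a x @ v))) (Q (appt D (appt a x)) v))"
      if \<Delta>: "set ?\<Delta> \<subseteq> set \<Delta>" and dx: "prv X R ?\<Gamma> \<Delta> (prec R (appt a x) x)" for \<Delta>
    proof -
      \<comment> \<open>\<open>?s\<close> puts \<open>a x\<close> for the bound tuple; its tail
        skips the block \<open>v\<close>, so that the outer tuple of \<open>?IH\<close> becomes
        \<open>x\<close>.\<close>
      let ?s = "cons_sub (appt a x) (\<lambda>i. Var (i + m))"
      have "prv X R ?\<Gamma> \<Delta> (lift_fm m ?IH)"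
      proof (rule Assm)
        show "wff X ?\<Gamma> (lift_fm m ?IH)"
          using lift_ty(2)[OF IH_wff, of m "rev V"] by (simp add: m_def)
      qed (use \<Delta> in simp)
      then have "prv X R ?\<Gamma> \<Delta> (sub_fm (\<lambda>i. Var (i + m)) ?IH)" by (simp only: ren_eq_sub)
      from ForallsE[OF this ax]
      have "prv X R ?\<Gamma> \<Delta> (Imp (prec R (map (sub ?s) (vars 0 n)) (map (sub ?s) (vars n n)))
          (sub_fm ?s (inst_fm (n + n) (vars 0 n) ?A)))"
        by (simp only: sub_fm.simps sub_prec)
      moreover have "map (sub ?s) (vars 0 n) = appt a x" by (simp add: lens)
      moreover have "map (sub ?s) (vars n n) = x"
        using sub_vars_shift[of n "appt a x" "\<lambda>i. Var (i + m)" 0 n]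
        by (simp add: lens sub_vars_ren x_def)
      moreover have "sub_fm ?s (inst_fm (n + n) (vars 0 n) ?A) = sub_fm (cons_sub (appt a x) ?sh) ?A"
      proof -
        have "(\<lambda>i. sub ?s (Var (i + (n + n)))) = ?sh"
          by (auto simp: fun_eq_iff cons_sub_def lens)
        then show ?thesis
          by (simp only: tuple_sub_eq sub_sub sub_cons_sub) (simp add: lens)
      qed
      ultimately have "prv X R ?\<Gamma> \<Delta>
          (Imp (prec R (appt a x) x) (sub_fm (cons_sub (appt a x) ?sh) ?A))"
        by (simp only:)
      from ForallsE[OF ImpE[OF this dx] v]
      have "prv X R ?\<Gamma> \<Delta> (sub_fm (cons_sub (appt a x @ v) ?sh) ?K)"
        by (simp only: cons_sub_append)
      moreover have "map (sub (cons_sub (appt a x @ v) ?sh)) B' = B'"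
        by (simp add: B'_def sub_sub lens)
      moreover have "map (sub (cons_sub (appt a x @ v) ?sh)) D = D"
        using sub_closeds[OF D_ty] by (simp add: D_def)
      ultimately show ?thesis
        by (simp add: Q_def sub_p phi_sub sub_x sub_v sub_appt lens)
    qed
    have p: "prv X R ?\<Gamma> \<Delta> (p x (appt B' (x @ v)))" if "set ?\<Delta> \<subseteq> set \<Delta>" for \<Delta>
      by (rule Assm[OF _ p_wff[OF x Bx]]) (use that in simp)
    show ?thesis
    proof (rule OrE[OF hyp[of "dec (phi x)"]])
      let ?\<Delta>1 = "phi x # ?\<Delta>"
      have sub: "set ?\<Delta> \<subseteq> set ?\<Delta>1" by auto
      have ph: "prv X R ?\<Gamma> ?\<Delta>1 (phi x)" by (rule Assm[OF _ phi_wff[OF x]]) simp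
      have dx: "prv X R ?\<Gamma> ?\<Delta>1 (prec R (appt a x) x)" by (rule ImpE[OF d_hyp[OF sub] ph])
      have s: "prv X R ?\<Gamma> ?\<Delta>1 (step_hyp x)"
        using AndI[OF d_hyp[OF sub] ph] by (simp only: step_hyp_def)
      \<comment> \<open>From here the chain is \<open>?C2\<close>, then the triple at
        \<open>B (a x) v\<close>, then the induction hypothesis at \<open>a x\<close>, and finally
        \<open>?C1\<close> back to \<open>D x\<close>.\<close>
      have "prv X R ?\<Gamma> ?\<Delta>1 (p x (appt \<alpha>' (x @ appt B' (appt a x @ v))))"
        by (rule ImpE[OF ImpE[OF hyp[OF _ sub] s] p[OF sub]]) simp
      from ImpE[OF T_hyp[OF Bax sub] AndI[OF this ph]]
      have "prv X R ?\<Gamma> ?\<Delta>1 (p (appt a x) (appt B' (appt a x @ v)))" .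
      from ImpE[OF IH_hyp[OF sub dx] this]
      show "prv X R ?\<Gamma> ?\<Delta>1 (Q (appt D x) v)"
        by (rule ImpE[OF ImpE[OF hyp[OF _ sub] s], rotated]) simp
    next
      let ?\<Delta>1 = "Neg (phi x) # ?\<Delta>"
      have sub: "set ?\<Delta> \<subseteq> set ?\<Delta>1" by auto
      have nph: "prv X R ?\<Gamma> ?\<Delta>1 (Neg (phi x))" by (rule Assm[OF _ np(2)]) simp
      \<comment> \<open>\<open>?N2\<close> turns the hypothesis into P(x, v); with the negation of
        \<phi> this is the conclusion at \<open>x\<close>, which \<open>?N1\<close> carries to
        \<open>D x\<close>.\<close>
      have "prv X R ?\<Gamma> ?\<Delta>1 (p x v)"
        by (rule ImpE[OF ImpE[OF hyp[OF _ sub] nph] p[OF sub]]) simp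
      then have "prv X R ?\<Gamma> ?\<Delta>1 (Q x v)" using AndI[OF _ nph] by (simp only: Q_def)
      then show "prv X R ?\<Gamma> ?\<Delta>1 (Q (appt D x) v)"
        by (rule ImpE[OF ImpE[OF hyp[OF _ sub] nph], rotated]) simp
    qed simp_all
  qed
  have "prv X R \<Gamma> [] (Foralls X (Imp ?IH ?A))"
  \<comment> \<open>\<open>IND\<close> accepts its premise only without open assumptions, so the
    auxiliary theorems are discharged before it is applied.\<close>
  proof (rule cut[OF \<Theta>])
    have "prv X R (rev V @ rev X @ \<Gamma>) (map (lift_fm m) (?IH # map (lift_fm n) ?\<Theta>)) ?K"
      by (rule ImpI) (use main p_wff[OF x Bx] in simp_all)
    then have "prv X R (rev X @ \<Gamma>) (?IH # map (lift_fm n) ?\<Theta>) ?A"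
      unfolding m_def by (rule ForallsI)
    then have "prv X R (rev X @ \<Gamma>) (map (lift_fm n) ?\<Theta>) (Imp ?IH ?A)"
      by (rule ImpI[OF IH_wff])
    then show "prv X R \<Gamma> ?\<Theta> (Foralls X (Imp ?IH ?A))"
      unfolding n_def by (rule ForallsI)
  qed assumption
  from IND[OF A_wff n_def[THEN meta_eq_to_obj_eq] refl refl this]
  have "prv X R \<Gamma> [] (Foralls X ?A)" .
  then show ?thesis
    unfolding lift_eq B'_def[symmetric] p_inst
    by (simp add: Foralls_append Q_def phi_inst lens)
qed

end
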